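(* For every real $\alpha \in [0,1)$ and every Martin-Löf random real $\beta \in [0,1)$, there exists a real constant $d \geq 0$ such that, for every nondecreasing translation function $g$ from $\beta$ to $\alpha$, it holds that $$\lim_{q \nearrow \beta} \frac{\alpha - g(q)}{\beta - q} = d.$$
   Context: All rational and real numbers ($\alpha$, $\beta$, arguments and values of $g$) are in the unit interval $[0,1)$. The notation $\lim_{q\nearrow\beta}$ denotes the left limit, where $q$ ranges over rationals $q<\beta$ in $[0,1)$. A translation function from a real $\beta$ to a real $\alpha$ is a partially computable function $g$ from the set $\mathbb{Q}\cap[0,1)$ to itself such that, for all rationals $q \in [0,1)$ with $q<\beta$, the value $g(q)$ is defined and fulfills $g(q)<\alpha$, and such that $\lim_{q\nearrow\beta} g(q)=\alpha$. (The function $g$ may also be defined on some rationals $q \ge \beta$.) It is nondecreasing if $g(p)\le g(q)$ for all $p\le q$ in its domain. A real $\beta$ is Martin-Löf random if for every Martin-Löf test, i.e., every uniformly computably enumerable sequence $S_0,S_1,\dots$ of sets of intervals with rational endpoints such that for every $i$ the sum of the lengths of the intervals in $S_i$ is at most $2^{-(i+1)}$, there is some $i$ such that $\beta$ is in no interval of $S_i$. *)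

theory Defs
  imports "HOL-Analysis.Analysis" "HOL-Library.Countable" "HOL-Library.Nat_Bijection"
begin

primrec primitive_recursion :: "(nat \<rightharpoonup> nat) \<Rightarrow> (nat \<rightharpoonup> nat) \<Rightarrow> nat \<Rightarrow> nat \<rightharpoonup> nat" where
  "primitive_recursion f g a 0 = f a"
| "primitive_recursion f g a (Suc n) =
     Option.bind (primitive_recursion f g a n) (\<lambda>v. g (prod_encode (a, prod_encode (n, v))))"

text \<open>The \<open>\<mu>\<close>-operator is defined at \<open>a\<close> only if the search meets no undefined value
  before it reaches a zero.\<close>

definition minimization :: "(nat \<rightharpoonup> nat) \<Rightarrow> nat \<rightharpoonup> nat" where
  "minimization f a =
    (let found = (\<lambda>n. f (prod_encode (a, n)) = Some 0 \<and> (\<forall>m<n. f (prod_encode (a, m)) \<noteq> None))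
     in if \<exists>n. found n then Some (LEAST n. found n) else None)"

text \<open>Kleene's partial recursive functions. All functions are unary; several arguments are
  passed as one number by means of \<open>prod_encode\<close>.\<close>

inductive partial_recursive :: "(nat \<rightharpoonup> nat) \<Rightarrow> bool" where
  zero: "partial_recursive (\<lambda>_. Some 0)"
| succ: "partial_recursive (\<lambda>n. Some (Suc n))"
| left: "partial_recursive (\<lambda>n. Some (fst (prod_decode n)))"
| right: "partial_recursive (\<lambda>n. Some (snd (prod_decode n)))"
| pair: "partial_recursive f \<Longrightarrow> partial_recursive g \<Longrightarrow>
    partial_recursive (\<lambda>n. Option.bind (f n) (\<lambda>x. Option.bind (g n) (\<lambda>y. Some (prod_encode (x, y)))))"
| comp: "partial_recursive f \<Longrightarrow> partial_recursive g \<Longrightarrow>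
    partial_recursive (\<lambda>n. Option.bind (g n) f)"
| prec: "partial_recursive f \<Longrightarrow> partial_recursive g \<Longrightarrow>
    partial_recursive (\<lambda>n. primitive_recursion f g (fst (prod_decode n)) (snd (prod_decode n)))"
| mu: "partial_recursive f \<Longrightarrow> partial_recursive (minimization f)"

definition computably_enumerable :: "nat set \<Rightarrow> bool" where
  "computably_enumerable A \<longleftrightarrow> (\<exists>f. partial_recursive f \<and> dom f = A)"

text \<open>Rationals are represented through the effective numbering \<open>nat_to_rat_surj\<close>. It is
  surjective but not injective, hence a representing function has to behave in the same way on
  all codes of a rational; equality of the coded rationals is decidable, so this is no
  restriction.\<close>

definition partial_computable_rat :: "(rat \<rightharpoonup> rat) \<Rightarrow> bool" where
  "partial_computable_rat g \<longleftrightarrow>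
    (\<exists>f. partial_recursive f \<and>
      (\<forall>n. map_option nat_to_rat_surj (f n) = g (nat_to_rat_surj n)))"

text \<open>A pair \<open>(p, q)\<close> with \<open>p < q\<close> stands for the open interval from \<open>p\<close> to \<open>q\<close>. Uniform
  enumerability is enumerability of the set of all (codes of) triples \<open>(i, p, q)\<close> such that
  \<open>(p, q)\<close> belongs to \<open>S i\<close>.\<close>

definition uniformly_ce_intervals :: "(nat \<Rightarrow> (rat \<times> rat) set) \<Rightarrow> bool" where
  "uniformly_ce_intervals S \<longleftrightarrow>
    computably_enumerable
      {prod_encode (i, prod_encode (m, n)) | i m n. (nat_to_rat_surj m, nat_to_rat_surj n) \<in> S i}"

definition interval_length :: "rat \<times> rat \<Rightarrow> real" where
  "interval_length I = of_rat (snd I) - of_rat (fst I)"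

definition martin_loef_test :: "(nat \<Rightarrow> (rat \<times> rat) set) \<Rightarrow> bool" where
  "martin_loef_test S \<longleftrightarrow>
    (\<forall>i. \<forall>(p, q)\<in>S i. p < q) \<and>
    uniformly_ce_intervals S \<and>
    (\<forall>i. interval_length summable_on S i \<and> infsum interval_length (S i) \<le> 1 / 2 ^ (i + 1))"

definition martin_loef_random :: "real \<Rightarrow> bool" where
  "martin_loef_random \<beta> \<longleftrightarrow>
    (\<forall>S. martin_loef_test S \<longrightarrow> (\<exists>i. \<forall>(p, q)\<in>S i. \<beta> \<notin> {of_rat p<..<of_rat q}))"

text \<open>The filter of the left limit \<open>q \<nearrow> \<beta>\<close>, where \<open>q\<close> ranges over the rationals in \<open>[0,1)\<close>.\<close>

definition rat_at_left :: "real \<Rightarrow> rat filter" where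
  "rat_at_left \<beta> = inf (filtercomap of_rat (at_left \<beta>)) (principal {0..<1})"

definition translation_function :: "(rat \<rightharpoonup> rat) \<Rightarrow> real \<Rightarrow> real \<Rightarrow> bool" where
  "translation_function g \<beta> \<alpha> \<longleftrightarrow>
    dom g \<subseteq> {0..<1} \<and> ran g \<subseteq> {0..<1} \<and>
    partial_computable_rat g \<and>
    (\<forall>q\<in>{0..<1}. of_rat q < \<beta> \<longrightarrow> (\<exists>r. g q = Some r \<and> of_rat r < \<alpha>)) \<and>
    ((\<lambda>q. of_rat (the (g q))) \<longlongrightarrow> \<alpha>) (rat_at_left \<beta>)"

definition nondecreasing :: "(rat \<rightharpoonup> rat) \<Rightarrow> bool" where
  "nondecreasing g \<longleftrightarrow> (\<forall>p\<in>dom g. \<forall>q\<in>dom g. p \<le> q \<longrightarrow> the (g p) \<le> the (g q))"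

end

theory Submission imports Defs
begin

text \<open>The slope of a translation function \<open>g\<close> at \<open>q < \<beta>\<close> is \<open>(\<alpha> - g q) / (\<beta> - q)\<close>. For nondecreasing \<open>g\<close>
  it converges as \<open>q \<nearrow> \<beta>\<close>, with a limit that is the same for all \<open>g\<close>, as soon as three situations
  are excluded: the slope of \<open>g\<close> is unbounded (\<open>slope_bounded\<close>); for some \<open>c < d\<close> the slope of \<open>g\<close>
  is below \<open>c\<close> and above \<open>d\<close> arbitrarily close to \<open>\<beta>\<close> (\<open>slope_no_oscillation_rat\<close>); the slope of \<open>g\<close>
  is eventually below \<open>c\<close>, but that of \<open>h\<close> is above \<open>d\<close> arbitrarily close to \<open>\<beta>\<close>
  (\<open>slopes_agree_rat\<close>). In each of them \<open>\<beta>\<close> is not random, because in every dyadic cell around \<open>\<beta>\<close>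
  one can enumerate a cover of \<open>\<beta>\<close> whose measure is at most a fixed fraction \<open>\<kappa> < 1\<close> of the length
  of the cell. Repeating this inside of the cover yields covers of measure \<open>\<kappa> ^ j\<close> and hence a
  Martin-Loef test (\<open>not_random_if_nested_cover\<close>).

  As \<open>g\<close> and \<open>h\<close> may be undefined to the right of \<open>\<beta>\<close>, the location of \<open>\<beta>\<close> has to be predicted from
  values to its left. If the slope of \<open>h\<close> exceeds \<open>d\<close> at \<open>r\<close>, then \<open>h s - h r > d * (\<beta> - r)\<close> for all
  \<open>s < \<beta>\<close> close to \<open>\<beta>\<close>, so \<open>\<beta>\<close> lies between \<open>s\<close> and \<open>r + (h s - h r) / d\<close>. Read the values of \<open>h\<close> as
  the amount of work that has arrived at a server with service rate \<open>d\<close>. Then this says that the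
  server is busy at time \<open>\<beta>\<close>, and since it cannot be busy for longer than its work takes, the union
  of all predicted intervals has at most the measure of the total work divided by \<open>d\<close>
  (\<open>measure_busy_le\<close>).

  It remains to admit only pairs \<open>(r, s)\<close> whose total work is at most \<open>c\<close> times the length of the
  cell; this gives \<open>\<kappa> = c / d\<close>. For the oscillation of a single function, \<open>(r, s)\<close> is admitted if \<open>g
  s - g p \<le> c * (r - p)\<close> for some \<open>p < r\<close> in the cell. For two functions, \<open>p\<close> is one point fixed for
  the cell, and one admits the pairs with \<open>g p \<le> h r\<close> and \<open>h s - g p \<le> c * (r - p)\<close>. In both cases a
  slope of \<open>g\<close> below \<open>c\<close> at \<open>p\<close> guarantees that all \<open>(r, s)\<close> sufficiently close to \<open>\<beta>\<close> on its left
  are admitted. That the work is bounded is immediate for two functions; for a single function it is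
  \<open>measure_service_oscillation_le\<close>. For the unboundedness of the slope, the total variation of \<open>g\<close>
  bounds the work, and \<open>d\<close> is taken to be twice the reciprocal of the length of the cell.\<close>

section \<open>Recursive functions and decidable predicates\<close>

text \<open>Total recursive functions. The closure rules below are stated for functions written out as terms in
  one variable, so that \<open>intro\<close> proves recursiveness by following the syntax of the term.\<close>

definition recursive :: "(nat \<Rightarrow> nat) \<Rightarrow> bool" where
  "recursive f \<longleftrightarrow> partial_recursive (\<lambda>x. Some (f x))"

definition decidable :: "(nat \<Rightarrow> bool) \<Rightarrow> bool" where
  "decidable P \<longleftrightarrow> recursive (\<lambda>x. of_bool (P x))"

lemma recursive_compose: "recursive f \<Longrightarrow> recursive g \<Longrightarrow> recursive (\<lambda>x. f (g x))"
  unfolding recursive_def using partial_recursive.comp[of "\<lambda>x. Some (f x)" "\<lambda>x. Some (g x)"] by simp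

lemma decidable_compose: "decidable P \<Longrightarrow> recursive g \<Longrightarrow> decidable (\<lambda>x. P (g x))"
  unfolding decidable_def by (rule recursive_compose)

lemma recursive_pair: "recursive f \<Longrightarrow> recursive g \<Longrightarrow> recursive (\<lambda>x. prod_encode (f x, g x))"
  unfolding recursive_def using partial_recursive.pair[of "\<lambda>x. Some (f x)" "\<lambda>x. Some (g x)"] by simp

lemma recursive_fst: "recursive f \<Longrightarrow> recursive (\<lambda>x. fst (prod_decode (f x)))"
  by (rule recursive_compose[of "\<lambda>x. fst (prod_decode x)"]) (simp_all add: recursive_def partial_recursive.left)

lemma recursive_snd: "recursive f \<Longrightarrow> recursive (\<lambda>x. snd (prod_decode (f x)))"
  by (rule recursive_compose[of "\<lambda>x. snd (prod_decode x)"]) (simp_all add: recursive_def partial_recursive.right)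

lemma recursive_Suc: "recursive f \<Longrightarrow> recursive (\<lambda>x. Suc (f x))"
  by (rule recursive_compose[of Suc]) (simp_all add: recursive_def partial_recursive.succ)

lemma recursive_id: "recursive (\<lambda>x. x)"
  using recursive_pair[of "\<lambda>x. fst (prod_decode x)" "\<lambda>x. snd (prod_decode x)"]
  by (simp add: recursive_def partial_recursive.left partial_recursive.right)

lemma recursive_const: "recursive (\<lambda>x. c)"
proof (induction c)
  case 0
  then show ?case by (simp add: recursive_def partial_recursive.zero)
next
  case (Suc c)
  then show ?case by (rule recursive_Suc)
qed

lemma primitive_recursion_total:
  "primitive_recursion (\<lambda>x. Some (f x)) (\<lambda>x. Some (g x)) a n =
    Some (rec_nat (f a) (\<lambda>i v. g (prod_encode (a, prod_encode (i, v)))) n)"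
  by (induction n) auto

lemma recursive_rec_nat:
  assumes f: "recursive f" and b: "recursive b"
    and g: "recursive (\<lambda>z. g (fst (prod_decode z)) (fst (prod_decode (snd (prod_decode z))))
              (snd (prod_decode (snd (prod_decode z)))))"
  shows "recursive (\<lambda>x. rec_nat (f x) (g x) (b x))"
proof -
  let ?g = "\<lambda>z. g (fst (prod_decode z)) (fst (prod_decode (snd (prod_decode z))))
              (snd (prod_decode (snd (prod_decode z))))"
  have "partial_recursive (\<lambda>n. primitive_recursion (\<lambda>x. Some (f x)) (\<lambda>x. Some (?g x))
      (fst (prod_decode n)) (snd (prod_decode n)))"
    using f g unfolding recursive_def by (rule partial_recursive.prec)
  then have "recursive (\<lambda>n. rec_nat (f (fst (prod_decode n))) (g (fst (prod_decode n))) (snd (prod_decode n)))"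
    unfolding recursive_def primitive_recursion_total by simp
  from recursive_compose[OF this recursive_pair[OF recursive_id b]] show ?thesis by simp
qed

lemma recursive_add: "recursive f \<Longrightarrow> recursive g \<Longrightarrow> recursive (\<lambda>x. f x + g x)"
proof -
  have "rec_nat a (\<lambda>i v. Suc v) b = a + b" for a b by (induction b) auto
  then show "recursive f \<Longrightarrow> recursive g \<Longrightarrow> ?thesis"
    using recursive_rec_nat[of f g "\<lambda>x i v. Suc v"] by (simp add: recursive_Suc recursive_snd recursive_id)
qed

lemma recursive_mult: "recursive f \<Longrightarrow> recursive g \<Longrightarrow> recursive (\<lambda>x. f x * g x)"
proof -
  have eq: "rec_nat 0 (\<lambda>i v. v + a) b = a * b" for a b :: nat by (induction b) auto
  assume f: "recursive f" and g: "recursive g"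
  have "recursive (\<lambda>x. rec_nat 0 (\<lambda>i v. v + f x) (g x))"
    by (intro recursive_rec_nat recursive_const g recursive_add recursive_snd recursive_compose[OF f] recursive_fst recursive_id)
  then show ?thesis by (simp add: eq)
qed

lemma recursive_pred: "recursive f \<Longrightarrow> recursive (\<lambda>x. f x - 1)"
proof -
  have eq: "rec_nat 0 (\<lambda>i v. i) a = a - 1" for a by (cases a) auto
  assume f: "recursive f"
  have "recursive (\<lambda>x. rec_nat 0 (\<lambda>i v. i) (f x))"
    by (intro recursive_rec_nat recursive_const f recursive_snd recursive_fst recursive_id)
  then show ?thesis by (simp add: eq)
qed

lemma recursive_diff: "recursive f \<Longrightarrow> recursive g \<Longrightarrow> recursive (\<lambda>x. f x - g x)"
proof -
  have eq: "rec_nat a (\<lambda>i v. v - 1) b = a - b" for a b :: nat by (induction b) auto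
  assume f: "recursive f" and g: "recursive g"
  have "recursive (\<lambda>x. rec_nat (f x) (\<lambda>i v. v - 1) (g x))"
    by (intro recursive_rec_nat f g recursive_pred recursive_snd recursive_id)
  then show ?thesis by (simp only: eq)
qed

lemma recursive_power: "recursive f \<Longrightarrow> recursive (\<lambda>x. c ^ f x)"
proof -
  have eq: "rec_nat 1 (\<lambda>i v. v * c) b = c ^ b" for b :: nat by (induction b) auto
  assume f: "recursive f"
  have "recursive (\<lambda>x. rec_nat 1 (\<lambda>i v. v * c) (f x))"
    by (intro recursive_rec_nat f recursive_const recursive_mult recursive_snd recursive_id)
  then show ?thesis by (simp only: eq)
qed

lemma decidable_le: "recursive f \<Longrightarrow> recursive g \<Longrightarrow> decidable (\<lambda>x. f x \<le> g x)"
proof -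
  assume f: "recursive f" and g: "recursive g"
  have "recursive (\<lambda>x. 1 - (f x - g x))" by (intro recursive_diff recursive_const f g)
  moreover have "1 - (f x - g x) = of_bool (f x \<le> g x)" for x by auto
  ultimately show ?thesis by (simp only: decidable_def)
qed

lemma decidable_not: "decidable P \<Longrightarrow> decidable (\<lambda>x. \<not> P x)"
proof -
  assume "decidable P"
  then have "recursive (\<lambda>x. 1 - of_bool (P x))" unfolding decidable_def by (intro recursive_diff recursive_const)
  moreover have "1 - of_bool (P x) = (of_bool (\<not> P x) :: nat)" for x by auto
  ultimately show ?thesis by (simp only: decidable_def)
qed

lemma decidable_conj: "decidable P \<Longrightarrow> decidable Q \<Longrightarrow> decidable (\<lambda>x. P x \<and> Q x)"
  unfolding decidable_def of_bool_conj by (rule recursive_mult)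

lemma decidable_disj: "decidable P \<Longrightarrow> decidable Q \<Longrightarrow> decidable (\<lambda>x. P x \<or> Q x)"
  using decidable_not[OF decidable_conj[OF decidable_not decidable_not], of P Q] by simp

lemma decidable_less: "recursive f \<Longrightarrow> recursive g \<Longrightarrow> decidable (\<lambda>x. f x < g x)"
  using decidable_not[OF decidable_le[of g f]] by (simp add: not_le)

lemma decidable_eq: "recursive f \<Longrightarrow> recursive g \<Longrightarrow> decidable (\<lambda>x. f x = g x)"
  using decidable_conj[OF decidable_le decidable_le, of f g g f] by (simp add: order_eq_iff)

lemma recursive_If: "decidable P \<Longrightarrow> recursive f \<Longrightarrow> recursive g \<Longrightarrow> recursive (\<lambda>x. if P x then f x else g x)"
proof -
  assume P: "decidable P" and f: "recursive f" and g: "recursive g"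
  have "recursive (\<lambda>x. of_bool (P x) * f x + of_bool (\<not> P x) * g x)"
    using P decidable_not[OF P] unfolding decidable_def by (intro recursive_add recursive_mult f g)
  moreover have "of_bool (P x) * f x + of_bool (\<not> P x) * g x = (if P x then f x else g x)" for x by auto
  ultimately show ?thesis by simp
qed

lemma decidable_bex_le:
  assumes P: "decidable (\<lambda>z. P (fst (prod_decode z)) (snd (prod_decode z)))" and b: "recursive b"
  shows "decidable (\<lambda>x. \<exists>m\<le>b x. P x m)"
proof -
  have eq: "rec_nat 0 (\<lambda>i v. if P x i then 1 else v) n = of_bool (\<exists>m<n. P x m)" for x n
    by (induction n) (auto simp: less_Suc_eq)
  have "recursive (\<lambda>x. rec_nat 0 (\<lambda>i v. if P x i then 1 else v) (Suc (b x)))"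
  proof (intro recursive_rec_nat recursive_const recursive_Suc b recursive_If recursive_snd recursive_id)
    show "decidable (\<lambda>z. P (fst (prod_decode z)) (fst (prod_decode (snd (prod_decode z)))))"
      using decidable_compose[OF P recursive_pair[OF recursive_fst[OF recursive_id] recursive_fst[OF recursive_snd[OF recursive_id]]]] by simp
  qed
  then show ?thesis by (simp only: decidable_def eq less_Suc_eq_le)
qed

text \<open>The quotient is reached by counting up as long as the next multiple of the divisor does not exceed
  the dividend; as many rounds as the dividend says are enough.\<close>

lemma recursive_div: "recursive f \<Longrightarrow> recursive g \<Longrightarrow> recursive (\<lambda>x. f x div g x)"
proof -
  have aux: "rec_nat 0 (\<lambda>i v. if Suc v * b \<le> a then Suc v else v) n = min n (a div b)" if "b > 0" for a b n :: nat
  proof (induction n)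
    case (Suc n)
    have "Suc v * b \<le> a \<longleftrightarrow> v < a div b" for v
      using that by (simp add: less_eq_div_iff_mult_less_eq Suc_le_eq[symmetric])
    then show ?case using Suc by auto
  qed auto
  have eq: "(if b = 0 then 0 else rec_nat 0 (\<lambda>i v. if Suc v * b \<le> a then Suc v else v) a) = a div b" for a b :: nat
    using aux[of b a a] by (auto simp: min_absorb2)
  assume f: "recursive f" and g: "recursive g"
  have "recursive (\<lambda>x. if g x = 0 then 0 else rec_nat 0 (\<lambda>i v. if Suc v * g x \<le> f x then Suc v else v) (f x))"
    by (intro recursive_If decidable_eq recursive_rec_nat recursive_const f g decidable_le recursive_mult recursive_Suc recursive_snd
        recursive_compose[OF f] recursive_compose[OF g] recursive_fst recursive_id)
  then show ?thesis by (simp only: eq)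
qed

lemmas recursive_intros = recursive_id recursive_const recursive_fst recursive_snd recursive_pair
   recursive_Suc recursive_add recursive_mult recursive_diff recursive_power recursive_div recursive_If
   decidable_le decidable_less decidable_eq decidable_not decidable_conj decidable_disj decidable_bex_le

text \<open>Projections of decidable relations are domains of \<open>\<mu>\<close>-searches.\<close>

lemma computably_enumerable_projection:
  assumes "decidable (\<lambda>z. P (fst (prod_decode z)) (snd (prod_decode z)))"
  shows "computably_enumerable {n. \<exists>t. P n t}"
proof -
  let ?f = "\<lambda>z. of_bool (\<not> P (fst (prod_decode z)) (snd (prod_decode z))) :: nat"
  have "recursive ?f" using decidable_not[OF assms] by (simp add: decidable_def)
  then have "partial_recursive (minimization (\<lambda>z. Some (?f z)))"
    unfolding recursive_def by (rule partial_recursive.mu)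
  moreover have "dom (minimization (\<lambda>z. Some (?f z))) = {n. \<exists>t. P n t}"
    by (auto simp: minimization_def Let_def split: if_splits)
  ultimately show ?thesis unfolding computably_enumerable_def by blast
qed

section \<open>Stage-wise evaluation of partial recursive functions\<close>

text \<open>The domain of a partial recursive function is explored in stages: \<open>F \<langle>n, t\<rangle>\<close> is \<open>0\<close> if the
  computation of \<open>f n\<close> has not yet succeeded at stage \<open>t\<close>, and otherwise the successor of the value,
  which later stages keep. A common stage then serves finitely many values at once, which replaces
  dovetailing.\<close>

definition staged :: "(nat \<rightharpoonup> nat) \<Rightarrow> (nat \<Rightarrow> nat) \<Rightarrow> bool" where
  "staged f F \<longleftrightarrow> recursive F \<and>
    (\<forall>n s t v. F (prod_encode (n, s)) = Suc v \<longrightarrow> s \<le> t \<longrightarrow> F (prod_encode (n, t)) = Suc v) \<and>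
    (\<forall>n v. f n = Some v \<longleftrightarrow> (\<exists>t. F (prod_encode (n, t)) = Suc v))"

lemma stagedD:
  assumes "staged f F"
  shows "recursive F" and "F (prod_encode (n, s)) = Suc v \<Longrightarrow> s \<le> t \<Longrightarrow> F (prod_encode (n, t)) = Suc v"
    and "f n = Some v \<longleftrightarrow> (\<exists>t. F (prod_encode (n, t)) = Suc v)"
  using assms unfolding staged_def by blast+

lemma staged_total:
  assumes "recursive f"
  shows "\<exists>F. staged (\<lambda>n. Some (f n)) F"
proof -
  have "recursive (\<lambda>z. Suc (f (fst (prod_decode z))))"
    by (intro recursive_Suc recursive_compose[OF assms] recursive_fst recursive_id)
  then have "staged (\<lambda>n. Some (f n)) (\<lambda>z. Suc (f (fst (prod_decode z))))"
    by (simp add: staged_def)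
  then show ?thesis by blast
qed

lemma staged_pair:
  assumes F: "staged f F" and G: "staged g G"
  shows "\<exists>H. staged (\<lambda>n. Option.bind (f n) (\<lambda>x. Option.bind (g n) (\<lambda>y. Some (prod_encode (x, y))))) H"
proof -
  define H where "H z = (if F z = 0 \<or> G z = 0 then 0 else Suc (prod_encode (F z - 1, G z - 1)))" for z
  have H_Suc: "H z = Suc v \<longleftrightarrow> (\<exists>x y. F z = Suc x \<and> G z = Suc y \<and> v = prod_encode (x, y))" for z v
    unfolding H_def by (cases "F z"; cases "G z") auto
  have "recursive H"
    unfolding H_def using stagedD(1)[OF F] stagedD(1)[OF G] by (intro recursive_intros)
  moreover have "H (prod_encode (n, s)) = Suc v \<Longrightarrow> s \<le> t \<Longrightarrow> H (prod_encode (n, t)) = Suc v" for n s t v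
    unfolding H_Suc using stagedD(2)[OF F] stagedD(2)[OF G] by blast
  moreover have "Option.bind (f n) (\<lambda>x. Option.bind (g n) (\<lambda>y. Some (prod_encode (x, y)))) = Some v
      \<longleftrightarrow> (\<exists>t. H (prod_encode (n, t)) = Suc v)" for n v
  proof
    assume "Option.bind (f n) (\<lambda>x. Option.bind (g n) (\<lambda>y. Some (prod_encode (x, y)))) = Some v"
    then obtain x y where "f n = Some x" "g n = Some y" and v: "v = prod_encode (x, y)"
      by (auto simp: bind_eq_Some_conv)
    then obtain s t where "F (prod_encode (n, s)) = Suc x" "G (prod_encode (n, t)) = Suc y"
      using stagedD(3)[OF F] stagedD(3)[OF G] by blast
    then have "F (prod_encode (n, max s t)) = Suc x" "G (prod_encode (n, max s t)) = Suc y"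
      using stagedD(2)[OF F, of n s x "max s t"] stagedD(2)[OF G, of n t y "max s t"] by auto
    then show "\<exists>t. H (prod_encode (n, t)) = Suc v" unfolding H_Suc using v by blast
  next
    assume "\<exists>t. H (prod_encode (n, t)) = Suc v"
    then obtain t x y where "F (prod_encode (n, t)) = Suc x" "G (prod_encode (n, t)) = Suc y"
      and v: "v = prod_encode (x, y)" unfolding H_Suc by blast
    then have "f n = Some x" "g n = Some y" using stagedD(3)[OF F] stagedD(3)[OF G] by blast+
    then show "Option.bind (f n) (\<lambda>x. Option.bind (g n) (\<lambda>y. Some (prod_encode (x, y)))) = Some v"
      using v by simp
  qed
  ultimately show ?thesis unfolding staged_def by blast
qed

lemma staged_comp:
  assumes F: "staged f F" and G: "staged g G"
  shows "\<exists>H. staged (\<lambda>n. Option.bind (g n) f) H"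
proof -
  define H where "H z = (if G z = 0 then 0 else F (prod_encode (G z - 1, snd (prod_decode z))))" for z
  have H_Suc: "H (prod_encode (n, t)) = Suc v \<longleftrightarrow>
      (\<exists>y. G (prod_encode (n, t)) = Suc y \<and> F (prod_encode (y, t)) = Suc v)" for n t v
    unfolding H_def by (cases "G (prod_encode (n, t))") auto
  have "recursive H"
    unfolding H_def using stagedD(1)[OF G] by (intro recursive_intros recursive_compose[OF stagedD(1)[OF F]])
  moreover have "H (prod_encode (n, s)) = Suc v \<Longrightarrow> s \<le> t \<Longrightarrow> H (prod_encode (n, t)) = Suc v" for n s t v
    unfolding H_Suc using stagedD(2)[OF F] stagedD(2)[OF G] by blast
  moreover have "Option.bind (g n) f = Some v \<longleftrightarrow> (\<exists>t. H (prod_encode (n, t)) = Suc v)" for n v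
  proof
    assume "Option.bind (g n) f = Some v"
    then obtain y where "g n = Some y" "f y = Some v" by (auto simp: bind_eq_Some_conv)
    then obtain s t where "G (prod_encode (n, s)) = Suc y" "F (prod_encode (y, t)) = Suc v"
      using stagedD(3)[OF F] stagedD(3)[OF G] by blast
    then have "G (prod_encode (n, max s t)) = Suc y" "F (prod_encode (y, max s t)) = Suc v"
      using stagedD(2)[OF G, of n s y "max s t"] stagedD(2)[OF F, of y t v "max s t"] by auto
    then show "\<exists>t. H (prod_encode (n, t)) = Suc v" unfolding H_Suc by blast
  next
    assume "\<exists>t. H (prod_encode (n, t)) = Suc v"
    then obtain t y where "G (prod_encode (n, t)) = Suc y" "F (prod_encode (y, t)) = Suc v"
      unfolding H_Suc by blast
    then have "g n = Some y" "f y = Some v" using stagedD(3)[OF F] stagedD(3)[OF G] by blast+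
    then show "Option.bind (g n) f = Some v" by simp
  qed
  ultimately show ?thesis unfolding staged_def by blast
qed

text \<open>The stage-\<open>t\<close> approximation of a primitive recursion runs the recursion on the stage-\<open>t\<close>
  approximations of its two parts and stays at \<open>0\<close> once a part is undefined.\<close>

lemma staged_prec:
  assumes F: "staged f F" and G: "staged g G"
  shows "\<exists>H. staged (\<lambda>n. primitive_recursion f g (fst (prod_decode n)) (snd (prod_decode n))) H"
proof -
  define R where "R a t = rec_nat (F (prod_encode (a, t)))
    (\<lambda>i v. if v = 0 then 0 else G (prod_encode (prod_encode (a, prod_encode (i, v - 1)), t)))" for a t
  have R_0: "R a t 0 = F (prod_encode (a, t))" for a t by (simp add: R_def)
  have R_Suc: "R a t (Suc i) = Suc v \<longleftrightarrow> (\<exists>y. R a t i = Suc y \<and>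
      G (prod_encode (prod_encode (a, prod_encode (i, y)), t)) = Suc v)" for a t i v
    unfolding R_def by (cases "R a t i") (auto simp: R_def)
  have mono: "R a s i = Suc v \<Longrightarrow> s \<le> t \<Longrightarrow> R a t i = Suc v" for a s t i v
  proof (induction i arbitrary: v)
    case 0
    then show ?case unfolding R_0 using stagedD(2)[OF F] by blast
  next
    case (Suc i)
    then show ?case unfolding R_Suc using stagedD(2)[OF G] by blast
  qed
  have lim: "primitive_recursion f g a i = Some v \<longleftrightarrow> (\<exists>t. R a t i = Suc v)" for a i v
  proof (induction i arbitrary: v)
    case 0
    show ?case by (simp add: R_0 stagedD(3)[OF F])
  next
    case (Suc i)
    show ?case
    proof
      assume "primitive_recursion f g a (Suc i) = Some v"
      then obtain y where "primitive_recursion f g a i = Some y"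
        and g: "g (prod_encode (a, prod_encode (i, y))) = Some v" by (auto simp: bind_eq_Some_conv)
      then obtain s where s: "R a s i = Suc y" using Suc by blast
      obtain t where t: "G (prod_encode (prod_encode (a, prod_encode (i, y)), t)) = Suc v"
        using g stagedD(3)[OF G] by blast
      have "R a (max s t) (Suc i) = Suc v"
        unfolding R_Suc using mono[OF s, of "max s t"] stagedD(2)[OF G t, of "max s t"] by auto
      then show "\<exists>t. R a t (Suc i) = Suc v" by blast
    next
      assume "\<exists>t. R a t (Suc i) = Suc v"
      then obtain t y where "R a t i = Suc y" "G (prod_encode (prod_encode (a, prod_encode (i, y)), t)) = Suc v"
        unfolding R_Suc by blast
      then have "primitive_recursion f g a i = Some y" "g (prod_encode (a, prod_encode (i, y))) = Some v"
        using Suc stagedD(3)[OF G] by blast+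
      then show "primitive_recursion f g a (Suc i) = Some v" by simp
    qed
  qed
  define H where "H z = R (fst (prod_decode (fst (prod_decode z)))) (snd (prod_decode z))
    (snd (prod_decode (fst (prod_decode z))))" for z
  have "recursive H"
    unfolding H_def R_def
    by (intro recursive_rec_nat recursive_intros recursive_compose[OF stagedD(1)[OF F]] recursive_compose[OF stagedD(1)[OF G]])
  moreover have H: "H (prod_encode (n, t)) = R (fst (prod_decode n)) t (snd (prod_decode n))" for n t
    by (simp add: H_def)
  ultimately have "staged (\<lambda>n. primitive_recursion f g (fst (prod_decode n)) (snd (prod_decode n))) H"
    unfolding staged_def H lim using mono by blast
  then show ?thesis by blast
qed

text \<open>The search stops at the first zero, so all earlier values are defined and positive. In this form the
  result is determined without reference to a least element.\<close>

lemma minimization_eq_Some_iff: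
  "minimization f a = Some n \<longleftrightarrow> f (prod_encode (a, n)) = Some 0 \<and>
    (\<forall>m<n. \<exists>v. f (prod_encode (a, m)) = Some (Suc v))"
proof -
  define h where "h m = f (prod_encode (a, m))" for m
  define found where "found n \<longleftrightarrow> h n = Some 0 \<and> (\<forall>m<n. h m \<noteq> None)" for n
  have "minimization f a = Some n \<longleftrightarrow> (\<exists>n. found n) \<and> (LEAST n. found n) = n"
    unfolding minimization_def Let_def found_def h_def by simp
  also have "\<dots> \<longleftrightarrow> found n \<and> (\<forall>m<n. \<not> found m)"
    by (metis LeastI Least_equality not_less not_less_Least)
  also have "\<dots> \<longleftrightarrow> h n = Some 0 \<and> (\<forall>m<n. \<exists>v. h m = Some (Suc v))"
  proof (intro iffI conjI allI impI)
    assume *: "found n \<and> (\<forall>m<n. \<not> found m)"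
    show "h n = Some 0" using * found_def by blast
    fix m assume m: "m < n"
    have "h m \<noteq> None" using * m found_def by blast
    moreover have "h m \<noteq> Some 0"
    proof
      assume "h m = Some 0"
      moreover have "\<forall>i<m. h i \<noteq> None" using * m less_trans[OF _ m] by (auto simp: found_def)
      ultimately have "found m" unfolding found_def by blast
      then show False using * m by blast
    qed
    ultimately show "\<exists>v. h m = Some (Suc v)" using not0_implies_Suc by auto
  next
    assume *: "h n = Some 0 \<and> (\<forall>m<n. \<exists>v. h m = Some (Suc v))"
    show "found n" unfolding found_def using * by (metis option.distinct(1))
    show "\<not> found m" if "m < n" for m
      unfolding found_def using * that by (metis nat.distinct(1) option.inject)
  qed
  finally show ?thesis unfolding h_def .
qed

text \<open>Stage \<open>t\<close> of the \<open>\<mu>\<close>-operator tests the candidates below \<open>t\<close>. A candidate counts only if all smaller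
  ones already have a positive value at this stage; hence at most one candidate ever counts, and it
  never changes.\<close>

lemma staged_mu:
  assumes F: "staged f F"
  shows "\<exists>H. staged (minimization f) H"
proof -
  define found where "found a t n \<longleftrightarrow> F (prod_encode (prod_encode (a, n), t)) = 1 \<and>
    \<not> (\<exists>m\<le>n. m < n \<and> F (prod_encode (prod_encode (a, m), t)) \<le> 1)" for a t n
  define R where "R a t = rec_nat 0 (\<lambda>i v. if found a t i then Suc i else v)" for a t
  define H where "H z = R (fst (prod_decode z)) (snd (prod_decode z)) (snd (prod_decode z))" for z
  have found_iff: "found a t n \<longleftrightarrow> F (prod_encode (prod_encode (a, n), t)) = Suc 0 \<and>
      (\<forall>m<n. \<exists>v. F (prod_encode (prod_encode (a, m), t)) = Suc (Suc v))" for a t n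
  proof -
    have "\<not> x \<le> 1 \<longleftrightarrow> (\<exists>v. x = Suc (Suc v))" for x :: nat by presburger
    then show ?thesis unfolding found_def by auto
  qed
  have found_mono: "found a s n \<Longrightarrow> s \<le> t \<Longrightarrow> found a t n" for a s t n
    unfolding found_iff using stagedD(2)[OF F] by blast
  have found_unique: "\<not> m < n" if "found a t m" "found a t n" for a t m n
    using that unfolding found_iff by fastforce
  have R_Suc: "R a t b = Suc n \<longleftrightarrow> n < b \<and> found a t n" for a t b n
  proof (induction b)
    case (Suc b)
    have "R a t (Suc b) = (if found a t b then Suc b else R a t b)" by (simp add: R_def)
    then show ?case using Suc found_unique[of a t b n] found_unique[of a t n b]
      by (auto simp: less_Suc_eq)
  qed (simp add: R_def)
  have H_Suc: "H (prod_encode (a, t)) = Suc n \<longleftrightarrow> n < t \<and> found a t n" for a t n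
    by (simp add: H_def R_Suc)
  have "recursive H"
    unfolding H_def R_def found_def
    by (intro recursive_rec_nat recursive_intros recursive_compose[OF stagedD(1)[OF F]])
  moreover have "H (prod_encode (a, s)) = Suc n \<Longrightarrow> s \<le> t \<Longrightarrow> H (prod_encode (a, t)) = Suc n" for a s t n
    unfolding H_Suc using found_mono by auto
  moreover have "minimization f a = Some n \<longleftrightarrow> (\<exists>t. H (prod_encode (a, t)) = Suc n)" for a n
  proof
    assume "minimization f a = Some n"
    then have 0: "f (prod_encode (a, n)) = Some 0"
      and Suc: "\<forall>m<n. \<exists>v. f (prod_encode (a, m)) = Some (Suc v)"
      unfolding minimization_eq_Some_iff by auto
    obtain s where s: "F (prod_encode (prod_encode (a, n), s)) = Suc 0" using 0 stagedD(3)[OF F] by blast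
    have "\<forall>m. \<exists>t. m < n \<longrightarrow> (\<exists>v. F (prod_encode (prod_encode (a, m), t)) = Suc (Suc v))"
      using Suc stagedD(3)[OF F] by blast
    then obtain u where u: "\<And>m. m < n \<Longrightarrow> \<exists>v. F (prod_encode (prod_encode (a, m), u m)) = Suc (Suc v)"
      by metis
    define t where "t = Suc n + s + sum u {..<n}"
    have "u m \<le> t" if "m < n" for m
      using that member_le_sum[of m "{..<n}" u] unfolding t_def by (intro trans_le_add2) simp
    moreover have "s \<le> t" by (simp add: t_def)
    ultimately have "found a t n"
      unfolding found_iff using stagedD(2)[OF F] s u by blast
    then show "\<exists>t. H (prod_encode (a, t)) = Suc n" unfolding H_Suc by (intro exI[of _ t]) (simp add: t_def)
  next
    assume "\<exists>t. H (prod_encode (a, t)) = Suc n"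
    then obtain t where "found a t n" unfolding H_Suc by blast
    then show "minimization f a = Some n"
      unfolding minimization_eq_Some_iff found_iff using stagedD(3)[OF F] by blast
  qed
  ultimately show ?thesis unfolding staged_def by blast
qed

text \<open>Stages are built along the construction of the function from the basic ones.\<close>

lemma partial_recursive_staged: "partial_recursive f \<Longrightarrow> \<exists>F. staged f F"
proof (induction rule: partial_recursive.induct)
  case zero
  show ?case by (rule staged_total) (rule recursive_const)
next
  case succ
  show ?case by (rule staged_total) (intro recursive_Suc recursive_id)
next
  case left
  show ?case by (rule staged_total) (intro recursive_fst recursive_id)
next
  case right
  show ?case by (rule staged_total) (intro recursive_snd recursive_id)
qed (use staged_pair staged_comp staged_prec staged_mu in blast)+

section \<open>Rational-valued recursive functions\<close>

text \<open>A rational-valued function is given by a recursive numerator, written as a difference of natural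
  numbers, and a recursive positive denominator. Closure under the field operations and decidability
  of the order are then facts about natural numbers, and codes of rationals need never be produced,
  only compared.\<close>

definition recursive_rat :: "(nat \<Rightarrow> rat) \<Rightarrow> bool" where
  "recursive_rat F \<longleftrightarrow> (\<exists>a b c. recursive a \<and> recursive b \<and> recursive c \<and>
    (\<forall>x. F x = (of_nat (a x) - of_nat (b x)) / of_nat (Suc (c x))))"

lemma recursive_ratI:
  "recursive a \<Longrightarrow> recursive b \<Longrightarrow> recursive c \<Longrightarrow>
    (\<And>x. F x = (of_nat (a x) - of_nat (b x)) / of_nat (Suc (c x))) \<Longrightarrow> recursive_rat F"
  unfolding recursive_rat_def by blast

lemma recursive_rat_divI:
  assumes "recursive a" "recursive b" "recursive d" "\<And>x. d x > 0" "\<And>x. F x = (of_nat (a x) - of_nat (b x)) / of_nat (d x)"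
  shows "recursive_rat F"
  by (rule recursive_ratI[OF assms(1,2) recursive_pred[OF assms(3)]]) (use assms(4,5) in simp)

lemma recursive_ratE:
  assumes "recursive_rat F"
  obtains a b d where "recursive a" "recursive b" "recursive d" "\<And>x. d x > 0"
    "\<And>x. F x = (of_nat (a x) - of_nat (b x)) / of_nat (d x)"
proof -
  obtain a b c where *: "recursive a" "recursive b" "recursive c"
    and F: "\<And>x. F x = (of_nat (a x) - of_nat (b x)) / of_nat (Suc (c x))"
    using assms unfolding recursive_rat_def by blast
  show thesis by (rule that[OF *(1,2) recursive_Suc[OF *(3)] _ F]) simp
qed

lemma recursive_rat_of_nat: "recursive f \<Longrightarrow> recursive_rat (\<lambda>x. of_nat (f x))"
  by (rule recursive_ratI[of f "\<lambda>_. 0" "\<lambda>_. 0"]) (auto intro: recursive_const)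

lemma recursive_rat_add: "recursive_rat F \<Longrightarrow> recursive_rat G \<Longrightarrow> recursive_rat (\<lambda>x. F x + G x)"
proof (elim recursive_ratE)
  fix a b d a' b' d'
  assume *: "recursive a" "recursive b" "recursive d" "recursive a'" "recursive b'" "recursive d'"
    and pos: "\<And>x. 0 < d x" "\<And>x. 0 < d' x"
    and F: "\<And>x. F x = (of_nat (a x) - of_nat (b x)) / of_nat (d x)"
    and G: "\<And>x. G x = (of_nat (a' x) - of_nat (b' x)) / of_nat (d' x)"
  show "recursive_rat (\<lambda>x. F x + G x)"
  proof (rule recursive_rat_divI)
    show "recursive (\<lambda>x. a x * d' x + a' x * d x)" "recursive (\<lambda>x. b x * d' x + b' x * d x)" "recursive (\<lambda>x. d x * d' x)"
      by (intro recursive_add recursive_mult *)+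
    fix x
    show "F x + G x = (of_nat (a x * d' x + a' x * d x) - of_nat (b x * d' x + b' x * d x)) / of_nat (d x * d' x)"
      using pos[of x] by (simp add: F G add_frac_eq left_diff_distrib)
  qed (simp add: pos)
qed

lemma recursive_rat_minus: "recursive_rat F \<Longrightarrow> recursive_rat (\<lambda>x. - F x)"
  by (elim recursive_ratE, rule recursive_rat_divI) (assumption | simp add: minus_divide_left)+

lemma recursive_rat_diff: "recursive_rat F \<Longrightarrow> recursive_rat G \<Longrightarrow> recursive_rat (\<lambda>x. F x - G x)"
  using recursive_rat_add[OF _ recursive_rat_minus, of F G] by simp

lemma recursive_rat_mult: "recursive_rat F \<Longrightarrow> recursive_rat G \<Longrightarrow> recursive_rat (\<lambda>x. F x * G x)"
proof (elim recursive_ratE)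
  fix a b d a' b' d'
  assume *: "recursive a" "recursive b" "recursive d" "recursive a'" "recursive b'" "recursive d'"
    and pos: "\<And>x. 0 < d x" "\<And>x. 0 < d' x"
    and F: "\<And>x. F x = (of_nat (a x) - of_nat (b x)) / of_nat (d x)"
    and G: "\<And>x. G x = (of_nat (a' x) - of_nat (b' x)) / of_nat (d' x)"
  show "recursive_rat (\<lambda>x. F x * G x)"
  proof (rule recursive_rat_divI)
    show "recursive (\<lambda>x. a x * a' x + b x * b' x)" "recursive (\<lambda>x. a x * b' x + b x * a' x)" "recursive (\<lambda>x. d x * d' x)"
      by (intro recursive_add recursive_mult *)+
    fix x
    show "F x * G x = (of_nat (a x * a' x + b x * b' x) - of_nat (a x * b' x + b x * a' x)) / of_nat (d x * d' x)"
      unfolding F G times_divide_times_eq by (simp add: algebra_simps)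
  qed (simp add: pos)
qed

lemma recursive_rat_inverse: "recursive_rat F \<Longrightarrow> recursive_rat (\<lambda>x. inverse (F x))"
proof (elim recursive_ratE)
  fix a b d
  assume *: "recursive a" "recursive b" "recursive d" and pos: "\<And>x. 0 < d x"
    and F: "\<And>x. F x = (of_nat (a x) - of_nat (b x)) / of_nat (d x)"
  show "recursive_rat (\<lambda>x. inverse (F x))"
  proof (rule recursive_rat_divI)
    show "recursive (\<lambda>x. if b x < a x then d x else 0)" "recursive (\<lambda>x. if a x < b x then d x else 0)"
      "recursive (\<lambda>x. if a x = b x then 1 else (a x - b x) + (b x - a x))"
      by (intro recursive_intros *)+
    fix x
    show "inverse (F x) = (of_nat (if b x < a x then d x else 0) - of_nat (if a x < b x then d x else 0))
        / of_nat (if a x = b x then 1 else (a x - b x) + (b x - a x))"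
    proof (cases "a x" "b x" rule: linorder_cases)
      case less
      then have "F x = - (of_nat (b x - a x) / of_nat (d x))"
        by (simp add: F of_nat_diff minus_divide_left)
      then show ?thesis using less by simp
    next
      case greater
      then have "F x = of_nat (a x - b x) / of_nat (d x)"
        by (simp add: F of_nat_diff)
      then show ?thesis using greater by simp
    qed (simp add: F)
  qed auto
qed

lemma recursive_rat_divide: "recursive_rat F \<Longrightarrow> recursive_rat G \<Longrightarrow> recursive_rat (\<lambda>x. F x / G x)"
  unfolding divide_inverse by (intro recursive_rat_mult recursive_rat_inverse)

lemma recursive_rat_of_int_decode: "recursive f \<Longrightarrow> recursive_rat (\<lambda>x. of_int (int_decode (f x)))"
proof -
  assume f: "recursive f"
  have eq: "(of_int (int_decode n) :: rat) =
      (of_nat (if n = 2 * (n div 2) then n div 2 else 0) - of_nat (if n = 2 * (n div 2) then 0 else Suc (n div 2)))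
        / of_nat (Suc 0)" for n
    by (auto simp: int_decode_def sum_decode_def elim!: oddE)
  show ?thesis by (rule recursive_ratI[OF _ _ _ eq]) (intro recursive_intros f)+
qed

lemma recursive_rat_decode: "recursive f \<Longrightarrow> recursive_rat (\<lambda>x. nat_to_rat_surj (f x))"
proof -
  have eq: "nat_to_rat_surj n =
      of_int (int_decode (fst (prod_decode n))) / of_int (int_decode (snd (prod_decode n)))" for n
    by (simp add: nat_to_rat_surj_def split_beta Fract_of_int_quotient)
  show "recursive f \<Longrightarrow> ?thesis"
    unfolding eq by (intro recursive_rat_divide recursive_rat_of_int_decode recursive_intros)
qed

lemma recursive_rat_const: "recursive_rat (\<lambda>_. q)"
  using recursive_rat_decode[OF recursive_const, of "inv nat_to_rat_surj q"]
  by (simp add: surj_nat_to_rat_surj surj_f_inv_f)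

lemma decidable_rat_le: "recursive_rat F \<Longrightarrow> recursive_rat G \<Longrightarrow> decidable (\<lambda>x. F x \<le> G x)"
proof -
  assume "recursive_rat F" "recursive_rat G"
  then have "recursive_rat (\<lambda>x. G x - F x)" by (intro recursive_rat_diff)
  then obtain a b c where *: "recursive a" "recursive b"
    and eq: "\<And>x. G x - F x = (of_nat (a x) - of_nat (b x)) / of_nat (Suc (c x))"
    unfolding recursive_rat_def by blast
  have "F x \<le> G x \<longleftrightarrow> b x \<le> a x" for x
  proof -
    have "F x \<le> G x \<longleftrightarrow> 0 \<le> G x - F x" by simp
    also have "\<dots> \<longleftrightarrow> b x \<le> a x" unfolding eq by (simp add: zero_le_divide_iff)
    finally show ?thesis .
  qed
  then show ?thesis using decidable_le[OF *(2,1)] by simp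
qed

lemma decidable_rat_less: "recursive_rat F \<Longrightarrow> recursive_rat G \<Longrightarrow> decidable (\<lambda>x. F x < G x)"
  using decidable_not[OF decidable_rat_le[of G F]] by (simp add: not_le)

lemma decidable_rat_eq: "recursive_rat F \<Longrightarrow> recursive_rat G \<Longrightarrow> decidable (\<lambda>x. F x = G x)"
  using decidable_conj[OF decidable_rat_le decidable_rat_le, of F G G F] by (simp add: order_eq_iff)

lemmas recursive_rat_intros = recursive_rat_decode recursive_rat_of_nat recursive_rat_const
   recursive_rat_add recursive_rat_diff recursive_rat_mult recursive_rat_divide decidable_rat_le
   decidable_rat_less decidable_rat_eq

section \<open>Randomness tests from nested covers by dyadic cells\<close>

lemma recursive_rat_compose: "recursive_rat F \<Longrightarrow> recursive g \<Longrightarrow> recursive_rat (\<lambda>x. F (g x))"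
  by (erule recursive_ratE, rule recursive_rat_divI) (rule recursive_compose; assumption | assumption | simp)+

text \<open>All codes of an interval have to be enumerated, not just one. This is achieved by searching, for a
  given pair of codes, an enumerated interval with equal end points.\<close>

lemma uniformly_ce_intervalsI:
  assumes D: "decidable (\<lambda>z. D (fst (prod_decode z)) (snd (prod_decode z)))" and "recursive_rat L" "recursive_rat U"
  shows "uniformly_ce_intervals (\<lambda>i. {(L m, U m) | m. D i m})"
proof -
  let ?P = "\<lambda>n m. D (fst (prod_decode n)) m \<and> nat_to_rat_surj (fst (prod_decode (snd (prod_decode n)))) = L m
    \<and> nat_to_rat_surj (snd (prod_decode (snd (prod_decode n)))) = U m"
  have "decidable (\<lambda>z. D (fst (prod_decode (fst (prod_decode z)))) (snd (prod_decode z)))"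
    using decidable_compose[OF D recursive_pair[OF recursive_fst[OF recursive_fst[OF recursive_id]] recursive_snd[OF recursive_id]]] by simp
  then have "decidable (\<lambda>z. ?P (fst (prod_decode z)) (snd (prod_decode z)))"
    by (intro decidable_conj decidable_rat_eq recursive_rat_decode recursive_rat_compose[OF \<open>recursive_rat L\<close>] recursive_rat_compose[OF \<open>recursive_rat U\<close>]
        recursive_intros)
  then have "computably_enumerable {n. \<exists>m. ?P n m}" by (rule computably_enumerable_projection)
  moreover define T where "T i = {(L m, U m) | m. D i m}" for i
  have T: "(x, y) \<in> T i \<longleftrightarrow> (\<exists>m. D i m \<and> x = L m \<and> y = U m)" for x y i
    unfolding T_def by auto
  have "{n. \<exists>m. ?P n m} = {prod_encode (i, prod_encode (m, n)) | i m n.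
      (nat_to_rat_surj m, nat_to_rat_surj n) \<in> T i}"
  proof (rule set_eqI)
    fix n
    obtain i a b where n: "n = prod_encode (i, prod_encode (a, b))"
    proof -
      define c where "c = snd (prod_decode n)"
      have "n = prod_encode (fst (prod_decode n), prod_encode (fst (prod_decode c), snd (prod_decode c)))"
        by (simp add: c_def)
      then show thesis by (rule that)
    qed
    have "n \<in> {prod_encode (i, prod_encode (m, n)) | i m n. (nat_to_rat_surj m, nat_to_rat_surj n) \<in> T i}
        \<longleftrightarrow> (nat_to_rat_surj a, nat_to_rat_surj b) \<in> T i"
      by (auto simp: n)
    then show "n \<in> {n. \<exists>m. ?P n m} \<longleftrightarrow>
        n \<in> {prod_encode (i, prod_encode (m, n)) | i m n. (nat_to_rat_surj m, nat_to_rat_surj n) \<in> T i}"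
      by (simp add: T n)
  qed
  ultimately have "uniformly_ce_intervals T" unfolding uniformly_ce_intervals_def by simp
  then show ?thesis by (simp add: T_def[abs_def])
qed

text \<open>A rational is caught by the intervals of length \<open>2 ^ - (i + 2)\<close> around it.\<close>

lemma martin_loef_random_irrational:
  assumes "martin_loef_random \<beta>"
  shows "\<beta> \<noteq> of_rat q"
proof
  assume \<beta>: "\<beta> = of_rat q"
  define L where "L m = q - 1 / of_nat (2 ^ (m + 3))" for m
  define U where "U m = q + 1 / of_nat (2 ^ (m + 3))" for m
  define S where "S i = {(L m, U m) | m. m = i}" for i
  have S: "S i = {(L i, U i)}" for i unfolding S_def by blast
  have L: "of_rat (L m) = \<beta> - 1 / 2 ^ (m + 3)" for m
    unfolding L_def \<beta> of_rat_diff of_rat_divide of_rat_of_nat_eq of_rat_1 by simp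
  have U: "of_rat (U m) = \<beta> + 1 / 2 ^ (m + 3)" for m
    unfolding U_def \<beta> of_rat_add of_rat_divide of_rat_of_nat_eq of_rat_1 by simp
  have pos: "(0::real) < 1 / 2 ^ (m + 3)" for m by simp
  have "of_rat (L m) < (of_rat (U m) :: real)" for m using pos[of m] unfolding L U by linarith
  then have LU: "L m < U m" for m by (simp add: of_rat_less)
  have "recursive_rat L" "recursive_rat U" unfolding L_def[abs_def] U_def[abs_def] by (intro recursive_rat_intros recursive_intros)+
  then have "uniformly_ce_intervals S"
    unfolding S_def by (intro uniformly_ce_intervalsI decidable_eq recursive_intros)
  moreover have "interval_length (L i, U i) \<le> 1 / 2 ^ (i + 1)" for i
    unfolding interval_length_def fst_conv snd_conv L U by (simp add: power_add frac_le)
  ultimately have "martin_loef_test S"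
    unfolding martin_loef_test_def S using LU by simp
  then obtain i where "\<beta> \<notin> {of_rat (L i)<..<of_rat (U i)}"
    using assms unfolding martin_loef_random_def S by auto
  then show False using pos[of i] unfolding L U by simp
qed

text \<open>Cells are open, so the dyadic rationals are lost; random reals are irrational and do not notice.
  Working with cells turns unions into sums: among the cells on which something has been verified,
  those with no larger verified cell above them are pairwise disjoint.\<close>

definition cell :: "nat \<Rightarrow> nat \<Rightarrow> real set" where
  "cell n k = {real k / 2 ^ n<..<(real k + 1) / 2 ^ n}"

lemma cell_subset_ancestor:
  assumes "m \<le> n"
  shows "cell n k \<subseteq> cell m (k div 2 ^ (n - m))"
proof -
  define e where "e = n - m"
  have n: "n = m + e" using assms by (simp add: e_def)
  have "k div 2 ^ e * 2 ^ e \<le> k" "k + 1 \<le> (k div 2 ^ e + 1) * 2 ^ e"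
    by (simp_all add: div_times_less_eq_dividend Suc_le_eq dividend_less_div_times)
  then have "real (k div 2 ^ e * 2 ^ e) \<le> real k" "real (k + 1) \<le> real ((k div 2 ^ e + 1) * 2 ^ e)"
    by (simp_all only: of_nat_le_iff)
  then have "real (k div 2 ^ e) * 2 ^ e \<le> real k" "real k + 1 \<le> (real (k div 2 ^ e) + 1) * 2 ^ e"
    by (simp_all add: algebra_simps)
  then have "real (k div 2 ^ e) * 2 ^ e * 2 ^ m \<le> real k * 2 ^ m"
    "(real k + 1) * 2 ^ m \<le> (real (k div 2 ^ e) + 1) * 2 ^ e * 2 ^ m"
    by (auto intro!: mult_right_mono)
  then have "real (k div 2 ^ e) / 2 ^ m \<le> real k / 2 ^ n" "(real k + 1) / 2 ^ n \<le> (real (k div 2 ^ e) + 1) / 2 ^ m"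
    by (simp_all add: n power_add divide_le_eq le_divide_eq mult_ac)
  then show ?thesis
    unfolding cell_def e_def[symmetric] by auto
qed

lemma cells_level_disjoint: "k \<noteq> l \<Longrightarrow> cell n k \<inter> cell n l = {}"
proof -
  have *: "cell n k \<inter> cell n l = {}" if "k < l" for k l
  proof -
    have "(real k + 1) / 2 ^ n \<le> real l / 2 ^ n" using that by (intro divide_right_mono) auto
    then show ?thesis by (auto simp: cell_def)
  qed
  show "k \<noteq> l \<Longrightarrow> ?thesis" using *[of k l] *[of l k] by (cases k l rule: linorder_cases) auto
qed

lemma cells_disjoint:
  assumes "m \<le> n" "k div 2 ^ (n - m) \<noteq> i"
  shows "cell m i \<inter> cell n k = {}"
  using cell_subset_ancestor[OF assms(1), of k] cells_level_disjoint[OF assms(2), of m] by blast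

lemma measure_cell: "measure lborel (cell n k) = 1 / 2 ^ n"
  by (simp add: cell_def divide_right_mono diff_divide_distrib[symmetric])

text \<open>Here \<open>G m i n k\<close> says that the cell \<open>(n, k)\<close> is known to lie in the cover that belongs to its
  ancestor \<open>(m, i)\<close>. On the way down from the root to \<open>(n, k)\<close>, the state consists of the number of
  marks set so far and of the level of the last one; the next mark is set at the first cell that is
  known to lie in the cover belonging to the cell marked last. The cells carrying the \<open>j\<close>-th mark
  form the \<open>j\<close>-th of a sequence of nested covers. Enumerable covers admit a decidable \<open>G\<close>: a cell
  enters the cover only at a level that is large compared with the time needed to verify this. Then
  it is also decidable whether a cell carries the \<open>j\<close>-th mark.\<close>

fun path_state :: "(nat \<Rightarrow> nat \<Rightarrow> nat \<Rightarrow> nat \<Rightarrow> bool) \<Rightarrow> nat \<Rightarrow> nat \<Rightarrow> nat \<times> nat" where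
  "path_state G 0 k = (0, 0)"
| "path_state G (Suc n) k =
    (case path_state G n (k div 2) of (j, m) \<Rightarrow>
      if G m (k div 2 ^ (Suc n - m)) (Suc n) k then (Suc j, Suc n) else (j, m))"

definition marked :: "(nat \<Rightarrow> nat \<Rightarrow> nat \<Rightarrow> nat \<Rightarrow> bool) \<Rightarrow> nat \<Rightarrow> nat \<Rightarrow> nat \<Rightarrow> bool" where
  "marked G j n k \<longleftrightarrow> k < 2 ^ n \<and> path_state G n k = (j, n)"

lemma div_power_Suc: "m \<le> n \<Longrightarrow> (k::nat) div 2 div 2 ^ (n - m) = k div 2 ^ (Suc n - m)"
  by (simp add: div_mult2_eq[symmetric] Suc_diff_le)

lemma path_state_mark:
  assumes "path_state G n k = (j, m)"
  shows "m \<le> n" and "path_state G m (k div 2 ^ (n - m)) = (j, m)"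
proof -
  have "m \<le> n \<and> path_state G m (k div 2 ^ (n - m)) = (j, m)"
    using assms
  proof (induction n arbitrary: k j m)
    case (Suc n)
    obtain j' m' where s: "path_state G n (k div 2) = (j', m')" by (cases "path_state G n (k div 2)")
    have IH: "m' \<le> n" "path_state G m' (k div 2 div 2 ^ (n - m')) = (j', m')" using Suc.IH[OF s] by auto
    show ?case
    proof (cases "G m' (k div 2 ^ (Suc n - m')) (Suc n) k")
      case True
      then have "j = Suc j'" "m = Suc n" using Suc.prems s by auto
      then show ?thesis using Suc.prems by simp
    next
      case False
      then have "j = j'" "m = m'" using Suc.prems s by auto
      then show ?thesis using IH div_power_Suc[of m' n k] by simp
    qed
  qed auto
  then show "m \<le> n" "path_state G m (k div 2 ^ (n - m)) = (j, m)" by auto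
qed

lemma path_state_mono:
  "m \<le> n \<Longrightarrow> fst (path_state G m (k div 2 ^ (n - m))) \<le> fst (path_state G n k)"
proof (induction n arbitrary: k)
  case (Suc n)
  show ?case
  proof (cases "m = Suc n")
    case False
    then have "m \<le> n" using Suc.prems by simp
    then have "fst (path_state G m (k div 2 ^ (Suc n - m))) \<le> fst (path_state G n (k div 2))"
      using Suc.IH[of "k div 2"] div_power_Suc[of m n k] by simp
    also have "\<dots> \<le> fst (path_state G (Suc n) k)" by (auto split: prod.split)
    finally show ?thesis .
  qed simp
qed simp

lemma marked_parent:
  assumes "marked G (Suc j) n k"
  obtains m where "m < n" "marked G j m (k div 2 ^ (n - m))" "G m (k div 2 ^ (n - m)) n k"
proof -
  from assms obtain n' where n: "n = Suc n'" by (cases n) (auto simp: marked_def)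
  obtain i m where s: "path_state G n' (k div 2) = (i, m)" by (cases "path_state G n' (k div 2)")
  have m: "m \<le> n'" and ps: "path_state G m (k div 2 ^ (n - m)) = (i, m)"
    using path_state_mark[OF s] div_power_Suc[of m n' k] by (auto simp: n)
  have G: "G m (k div 2 ^ (n - m)) n k" and "i = j"
    using assms m s by (auto simp: marked_def n split: if_splits)
  have "k < 2 ^ (n - m) * 2 ^ m" using assms m by (simp add: marked_def n power_add[symmetric])
  then have "k div 2 ^ (n - m) < 2 ^ m" by (simp add: less_mult_imp_div_less mult.commute)
  then show thesis using that[of m] m ps G \<open>i = j\<close> by (simp add: marked_def n)
qed

text \<open>Passing a marked cell raises the number of marks for good, so a path meets its \<open>j\<close>-th mark only
  once.\<close>

lemma marked_antichain:
  assumes "marked G j m i" "marked G j n k" "m \<le> n" "k div 2 ^ (n - m) = i"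
  shows "m = n"
proof (rule ccontr)
  assume "m \<noteq> n"
  then obtain n' where n: "n = Suc n'" and m: "m \<le> n'" using assms(3) by (cases n) auto
  obtain j' m' where s: "path_state G n' (k div 2) = (j', m')" by (cases "path_state G n' (k div 2)")
  have "m' \<le> n'" using path_state_mark(1)[OF s] .
  then have "j = Suc j'" using assms(2) s by (auto simp: marked_def n split: if_splits)
  moreover have "j \<le> j'"
    using path_state_mono[OF m, of G "k div 2"] assms(1,4) s div_power_Suc[OF m, of k]
    by (simp add: marked_def n)
  ultimately show False by simp
qed

definition disjoint_cells :: "(nat \<times> nat) set \<Rightarrow> bool" where
  "disjoint_cells W \<longleftrightarrow> pairwise (\<lambda>(n, k) (m, i). cell n k \<inter> cell m i = {}) W"

lemma marked_disjoint: "disjoint_cells {(n, k). marked G j n k}"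
proof -
  have *: "cell m i \<inter> cell n k = {}" if "marked G j m i" "marked G j n k" "(m, i) \<noteq> (n, k)" "m \<le> n" for m i n k
  proof (rule cells_disjoint[OF \<open>m \<le> n\<close>], rule notI)
    assume "k div 2 ^ (n - m) = i"
    then show False using marked_antichain[OF that(1,2,4)] that(3) by auto
  qed
  show ?thesis
    unfolding disjoint_cells_def pairwise_def
  proof clarsimp
    fix n k m i assume "marked G j n k" "marked G j m i" "n = m \<longrightarrow> k \<noteq> i"
    then show "cell n k \<inter> cell m i = {}"
      using *[of m i n k] *[of n k m i] by (cases "n \<le> m") auto
  qed
qed

text \<open>Group the cells with mark \<open>j + 1\<close> by their ancestor with mark \<open>j\<close>: each group has at most the
  fraction \<open>\<kappa>\<close> of the length of its ancestor.\<close>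

lemma sum_marked_le:
  fixes \<kappa> :: real
  assumes \<kappa>: "0 \<le> \<kappa>"
    and shrink: "\<And>m i W. i < 2 ^ m \<Longrightarrow> finite W \<Longrightarrow> disjoint_cells W \<Longrightarrow>
      (\<And>n k. (n, k) \<in> W \<Longrightarrow> m < n \<and> k div 2 ^ (n - m) = i \<and> G m i n k) \<Longrightarrow>
      (\<Sum>(n, k)\<in>W. 1 / 2 ^ n) \<le> \<kappa> / 2 ^ m"
    and W: "finite W" "\<And>n k. (n, k) \<in> W \<Longrightarrow> marked G j n k"
  shows "(\<Sum>(n, k)\<in>W. 1 / 2 ^ n) \<le> \<kappa> ^ j"
  using W
proof (induction j arbitrary: W)
  case 0
  have "marked G 0 n k \<Longrightarrow> n = 0 \<and> k = 0" for n k
    using path_state_mark(1) by (cases n) (auto simp: marked_def split: prod.splits if_splits, fastforce)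
  then have "W \<subseteq> {(0, 0)}" using 0 by auto
  then have "(\<Sum>(n, k)\<in>W. 1 / 2 ^ n) \<le> (\<Sum>(n, k)\<in>{(0, 0::nat)}. 1 / 2 ^ n :: real)"
    by (intro sum_mono2) auto
  then show ?case by simp
next
  case (Suc j)
  define is_par where "is_par x m \<longleftrightarrow> m < fst x \<and> marked G j m (snd x div 2 ^ (fst x - m)) \<and>
    G m (snd x div 2 ^ (fst x - m)) (fst x) (snd x)" for x m
  have "\<exists>m. is_par x m" if "x \<in> W" for x
  proof -
    have "marked G (Suc j) (fst x) (snd x)" using Suc.prems(2)[of "fst x" "snd x"] that by simp
    then show ?thesis unfolding is_par_def by (rule marked_parent) blast
  qed
  then obtain par where par: "\<And>x. x \<in> W \<Longrightarrow> is_par x (par x)" by metis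
  define P where "P x = (par x, snd x div 2 ^ (fst x - par x))" for x
  have "(\<Sum>(n, k)\<in>W. 1 / 2 ^ n :: real) = (\<Sum>y\<in>P ` W. \<Sum>(n, k)\<in>{x \<in> W. P x = y}. 1 / 2 ^ n)"
    using Suc.prems(1) by (intro sum.image_gen)
  also have "\<dots> \<le> (\<Sum>y\<in>P ` W. \<kappa> / 2 ^ fst y)"
  proof (rule sum_mono)
    fix y assume "y \<in> P ` W"
    then obtain x where x: "x \<in> W" "y = P x" by blast
    obtain m i where y: "y = (m, i)" by (cases y)
    have "i < 2 ^ m" using par[OF x(1)] x(2) y by (auto simp: P_def marked_def is_par_def)
    moreover have "disjoint_cells {x \<in> W. P x = y}"
      using Suc.prems(2) unfolding disjoint_cells_def
      by (intro pairwise_subset[OF marked_disjoint[of G "Suc j", unfolded disjoint_cells_def]]) auto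
    moreover have "m < n \<and> k div 2 ^ (n - m) = i \<and> G m i n k" if "(n, k) \<in> {x \<in> W. P x = y}" for n k
      using par[of "(n, k)"] that by (auto simp: P_def y is_par_def)
    ultimately have "(\<Sum>(n, k)\<in>{x \<in> W. P x = y}. 1 / 2 ^ n) \<le> \<kappa> / 2 ^ m"
      using Suc.prems(1) by (intro shrink) auto
    then show "(\<Sum>(n, k)\<in>{x \<in> W. P x = y}. 1 / 2 ^ n) \<le> \<kappa> / 2 ^ fst y" by (simp add: y)
  qed
  also have "\<dots> = \<kappa> * (\<Sum>(m, i)\<in>P ` W. 1 / 2 ^ m)"
    by (simp add: sum_distrib_left split_beta)
  also have "\<dots> \<le> \<kappa> * \<kappa> ^ j"
  proof (intro mult_left_mono Suc.IH \<kappa>)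
    show "finite (P ` W)" using Suc.prems(1) by simp
    show "marked G j n k" if "(n, k) \<in> P ` W" for n k using that par by (auto simp: P_def is_par_def)
  qed
  finally show ?case by simp
qed

definition cell_index :: "real \<Rightarrow> nat \<Rightarrow> nat" where
  "cell_index x n = nat \<lfloor>x * 2 ^ n\<rfloor>"

lemma cell_index:
  assumes x: "0 \<le> x" "x < 1" and irr: "\<And>q. x \<noteq> of_rat q"
  shows "x \<in> cell n (cell_index x n)" and "cell_index x n < 2 ^ n"
    and "cell_index x (Suc n) div 2 = cell_index x n"
proof -
  have real_index: "real (cell_index x n) = of_int \<lfloor>x * 2 ^ n\<rfloor>" for n
    using x by (simp add: cell_index_def)
  have "x * 2 ^ n \<noteq> real (cell_index x n)"
  proof
    assume "x * 2 ^ n = real (cell_index x n)"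
    then have "x = of_rat (of_nat (cell_index x n) / 2 ^ n)"
      by (simp add: of_rat_divide of_rat_power field_simps)
    then show False using irr by blast
  qed
  moreover have "real (cell_index x n) \<le> x * 2 ^ n" "x * 2 ^ n < real (cell_index x n) + 1"
    unfolding real_index by linarith+
  ultimately show "x \<in> cell n (cell_index x n)"
    by (auto simp: cell_def field_simps)
  have "real (cell_index x n) < 2 ^ n"
    by (rule le_less_trans[OF \<open>real (cell_index x n) \<le> x * 2 ^ n\<close>]) (use x(2) in simp)
  then show "cell_index x n < 2 ^ n" by simp
  have "\<lfloor>x * 2 ^ Suc n\<rfloor> div 2 = \<lfloor>x * 2 ^ n\<rfloor>"
    using floor_divide_real_eq_div[of 2 "x * 2 ^ Suc n"] by simp
  moreover have "nat (\<lfloor>x * 2 ^ Suc n\<rfloor> div 2) = nat \<lfloor>x * 2 ^ Suc n\<rfloor> div 2"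
    by (simp only: nat_div_distrib' zero_le_numeral nat_numeral)
  ultimately show "cell_index x (Suc n) div 2 = cell_index x n"
    unfolding cell_index_def by simp
qed

text \<open>If the marks along the path to \<open>x\<close> ended, the last marked cell would have a cover that contains \<open>x\<close>,
  hence contains all sufficiently small cells around \<open>x\<close>, and one of them would get the next mark.\<close>

lemma marked_along_path:
  assumes idx: "\<And>n. x \<in> cell n (idx n)" "\<And>n. idx n < 2 ^ n" "\<And>n. idx (Suc n) div 2 = idx n"
    and cover: "\<And>m i. i < 2 ^ m \<Longrightarrow> x \<in> cell m i \<Longrightarrow> \<exists>N. \<forall>n k. N \<le> n \<longrightarrow> x \<in> cell n k \<longrightarrow> G m i n k"
  shows "\<exists>n. marked G j n (idx n)"
proof (induction j)
  case 0
  show ?case using idx(2)[of 0] by (auto simp: marked_def intro!: exI[of _ 0])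
next
  case (Suc j)
  then obtain m where m: "path_state G m (idx m) = (j, m)" by (auto simp: marked_def)
  have anc: "idx (m + d) div 2 ^ d = idx m" for d
  proof (induction d)
    case (Suc d)
    have "idx (m + Suc d) div 2 ^ Suc d = idx (Suc (m + d)) div 2 div 2 ^ d"
      by (simp add: div_mult2_eq)
    then show ?case using Suc idx(3) by simp
  qed simp
  obtain N where N: "\<And>n k. N \<le> n \<Longrightarrow> x \<in> cell n k \<Longrightarrow> G m (idx m) n k"
    using cover[OF idx(2) idx(1)] by blast
  have "G m (idx m) (m + Suc N) (idx (m + Suc N))" by (rule N) (use idx(1) in auto)
  then have ex: "\<exists>d. G m (idx m) (m + Suc d) (idx (m + Suc d))" by blast
  define d where "d = (LEAST d. G m (idx m) (m + Suc d) (idx (m + Suc d)))"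
  have G: "G m (idx m) (m + Suc d) (idx (m + Suc d))" unfolding d_def by (rule LeastI_ex[OF ex])
  have "path_state G (m + e) (idx (m + e)) = (j, m)" if "e \<le> d" for e
    using that
  proof (induction e)
    case (Suc e)
    then have "\<not> G m (idx m) (m + Suc e) (idx (m + Suc e))"
      unfolding d_def by (intro not_less_Least) simp
    then show ?case using Suc idx(3)[of "m + e"] anc[of "Suc e"] by (simp add: Suc_diff_le)
  qed (simp add: m)
  from this[of d] have "path_state G (m + Suc d) (idx (m + Suc d)) = (Suc j, m + Suc d)"
    using G idx(3)[of "m + d"] anc[of "Suc d"] by simp
  then have "marked G (Suc j) (m + Suc d) (idx (m + Suc d))" using idx(2) unfolding marked_def by blast
  then show ?case by blast
qed

text \<open>The recursion of \<open>path_state\<close> changes the index from \<open>k\<close> to \<open>k div 2\<close>. As a primitive recursion in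
  which \<open>k\<close> stays fixed, it computes at step \<open>l\<close> the state of the ancestor of \<open>(n, k)\<close> at level \<open>l\<close>.\<close>

lemma decidable_marked:
  assumes G: "\<And>M I N K. recursive M \<Longrightarrow> recursive I \<Longrightarrow> recursive N \<Longrightarrow> recursive K \<Longrightarrow> decidable (\<lambda>x. G (M x) (I x) (N x) (K x))"
    and rec: "recursive J" "recursive N" "recursive K"
  shows "decidable (\<lambda>x. marked G (J x) (N x) (K x))"
proof -
  define step where "step n k l v =
    (if G (snd (prod_decode v)) (k div 2 ^ (n - snd (prod_decode v))) (Suc l) (k div 2 ^ (n - Suc l))
     then prod_encode (Suc (fst (prod_decode v)), Suc l) else v)" for n k l v
  have eq: "l \<le> n \<Longrightarrow> rec_nat (prod_encode (0, 0)) (step n k) l = prod_encode (path_state G l (k div 2 ^ (n - l)))" for n k l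
  proof (induction l)
    case (Suc l)
    obtain j m where s: "path_state G l (k div 2 ^ (n - l)) = (j, m)" by (cases "path_state G l (k div 2 ^ (n - l))")
    have m: "m \<le> l" by (rule path_state_mark(1)[OF s])
    have "k div 2 ^ (n - Suc l) div 2 = k div 2 ^ (n - l)"
      using Suc.prems by (simp add: div_mult2_eq[symmetric] power_Suc2[symmetric] Suc_diff_Suc del: power_Suc)
    moreover have "k div 2 ^ (n - Suc l) div 2 ^ (Suc l - m) = k div 2 ^ (n - m)"
      using Suc.prems m by (simp add: div_mult2_eq[symmetric] power_add[symmetric])
    ultimately show ?case using Suc s by (simp add: step_def)
  qed simp
  have "recursive (\<lambda>x. rec_nat (prod_encode (0, 0)) (step (N x) (K x)) (N x))"
    unfolding step_def
    by (intro recursive_rec_nat recursive_If G recursive_intros recursive_compose[OF rec(2)] recursive_compose[OF rec(3)] rec(2))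
  then have "decidable (\<lambda>x. K x < 2 ^ N x \<and> rec_nat (prod_encode (0, 0)) (step (N x) (K x)) (N x) = prod_encode (J x, N x))"
    using rec by (intro recursive_intros)
  then show ?thesis by (simp add: eq marked_def)
qed

lemma summable_on_infsum_le:
  fixes f :: "'a \<Rightarrow> real"
  assumes "\<And>x. x \<in> A \<Longrightarrow> 0 \<le> f x" "\<And>F. finite F \<Longrightarrow> F \<subseteq> A \<Longrightarrow> sum f F \<le> c"
  shows "f summable_on A" and "infsum f A \<le> c"
proof -
  show s: "f summable_on A"
    by (rule nonneg_bdd_above_summable_on) (use assms in \<open>auto intro!: bdd_aboveI[of _ c]\<close>)
  show "infsum f A \<le> c"
    by (rule infsum_le_finite_sums[OF s assms(2)])
qed

text \<open>Suppose that every cell \<open>I\<close> around \<open>\<beta>\<close> comes with an enumerable cover of \<open>\<beta>\<close> by cells inside \<open>I\<close>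
  with total length at most \<open>\<kappa>\<close> times the length of \<open>I\<close>. Iterating the covers \<open>j\<close> times leaves cells
  of total length at most \<open>\<kappa> ^ j\<close>; a suitable arithmetic progression of values of \<open>j\<close> gives a
  Martin-Loef test.\<close>

theorem not_random_if_nested_cover:
  fixes \<beta> \<kappa> :: real
  assumes \<beta>: "\<beta> \<in> {0..<1}" and \<kappa>: "0 \<le> \<kappa>" "\<kappa> < 1"
    and G: "\<And>M I N K. recursive M \<Longrightarrow> recursive I \<Longrightarrow> recursive N \<Longrightarrow> recursive K \<Longrightarrow> decidable (\<lambda>x. G (M x) (I x) (N x) (K x))"
    and shrink: "\<And>m i W. i < 2 ^ m \<Longrightarrow> finite W \<Longrightarrow> disjoint_cells W \<Longrightarrow>
      (\<And>n k. (n, k) \<in> W \<Longrightarrow> m < n \<and> k div 2 ^ (n - m) = i \<and> G m i n k) \<Longrightarrow>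
      (\<Sum>(n, k)\<in>W. 1 / 2 ^ n) \<le> \<kappa> / 2 ^ m"
    and cover: "\<And>m i. i < 2 ^ m \<Longrightarrow> \<beta> \<in> cell m i \<Longrightarrow> \<exists>N. \<forall>n k. N \<le> n \<longrightarrow> \<beta> \<in> cell n k \<longrightarrow> G m i n k"
  shows "\<not> martin_loef_random \<beta>"
proof
  assume random: "martin_loef_random \<beta>"
  note index = cell_index[of \<beta>, OF _ _ martin_loef_random_irrational[OF random]]
  have marked: "\<exists>n. marked G j n (cell_index \<beta> n)" for j
    by (rule marked_along_path[OF _ _ _ cover]) (use index \<beta> in auto)
  obtain K where K: "\<kappa> ^ K < 1 / 2"
    using real_arch_pow_inv[of "1 / 2" \<kappa>] \<kappa> by auto
  define L where "L z = (of_nat (snd (prod_decode z)) / of_nat (2 ^ fst (prod_decode z)) :: rat)" for z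
  define U where "U z = (of_nat (snd (prod_decode z) + 1) / of_nat (2 ^ fst (prod_decode z)) :: rat)" for z
  define D where "D i z \<longleftrightarrow> marked G (K * (i + 1)) (fst (prod_decode z)) (snd (prod_decode z))" for i z
  define S where "S i = {(L z, U z) | z. D i z}" for i
  have L: "of_rat (L (prod_encode (n, k))) = real k / 2 ^ n" for n k
    by (simp add: L_def of_rat_divide of_rat_power)
  have U: "of_rat (U (prod_encode (n, k))) = (real k + 1) / 2 ^ n" for n k
    by (simp add: U_def of_rat_divide of_rat_power of_rat_add)
  have LU: "L z < U z" for z by (simp add: L_def U_def divide_strict_right_mono)
  have length: "interval_length (L z, U z) = 1 / 2 ^ fst (prod_decode z)" for z
    using L[of "fst (prod_decode z)" "snd (prod_decode z)"] U[of "fst (prod_decode z)" "snd (prod_decode z)"]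
    by (simp add: interval_length_def diff_divide_distrib[symmetric])
  have ce: "uniformly_ce_intervals S"
    unfolding S_def
  proof (rule uniformly_ce_intervalsI)
    show "decidable (\<lambda>z. D (fst (prod_decode z)) (snd (prod_decode z)))"
      unfolding D_def by (intro decidable_marked G recursive_intros)
    show "recursive_rat L" "recursive_rat U" unfolding L_def[abs_def] U_def[abs_def] by (intro recursive_rat_intros recursive_intros)+
  qed
  have sum: "sum interval_length F \<le> 1 / 2 ^ (i + 1)" if F: "finite F" "F \<subseteq> S i" for F i
  proof -
    have "\<forall>I\<in>F. \<exists>z. D i z \<and> I = (L z, U z)" using F unfolding S_def by blast
    then obtain z where z: "\<And>I. I \<in> F \<Longrightarrow> D i (z I) \<and> I = (L (z I), U (z I))" by metis
    define W where "W = (\<lambda>I. prod_decode (z I)) ` F"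
    have inj: "inj_on (\<lambda>I. prod_decode (z I)) F"
      by (rule inj_onI) (metis prod_decode_inverse z)
    have "sum interval_length F = (\<Sum>I\<in>F. 1 / 2 ^ fst (prod_decode (z I)))"
      using z length by (intro sum.cong) (metis (no_types))+
    also have "\<dots> = (\<Sum>(n, k)\<in>W. 1 / 2 ^ n)"
      unfolding W_def sum.reindex[OF inj] by (simp add: split_beta)
    also have "\<dots> \<le> \<kappa> ^ (K * (i + 1))"
    proof (rule sum_marked_le[OF \<kappa>(1) shrink])
      show "finite W" using F by (simp add: W_def)
      show "marked G (K * (i + 1)) n k" if nk: "(n, k) \<in> W" for n k
      proof -
        obtain I where I: "I \<in> F" "prod_decode (z I) = (n, k)" using nk unfolding W_def by force
        then show ?thesis using z[OF I(1)] by (simp add: D_def)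
      qed
    qed
    also have "\<dots> \<le> (1 / 2) ^ (i + 1)"
      unfolding power_mult using K \<kappa> by (intro power_mono) auto
    finally show ?thesis by (simp add: power_one_over)
  qed
  have nonneg: "interval_length I \<ge> 0" if "I \<in> S i" for I i
    using that length by (auto simp: S_def)
  have "interval_length summable_on S i \<and> infsum interval_length (S i) \<le> 1 / 2 ^ (i + 1)" for i
    using summable_on_infsum_le[of "S i" interval_length, OF nonneg sum] by simp
  moreover have "\<forall>(p, q)\<in>S i. p < q" for i using LU by (auto simp: S_def)
  ultimately have "martin_loef_test S"
    using ce unfolding martin_loef_test_def by blast
  then obtain i where i: "\<forall>(p, q)\<in>S i. \<beta> \<notin> {of_rat p<..<of_rat q}"
    using random unfolding martin_loef_random_def by blast
  obtain n where n: "marked G (K * (i + 1)) n (cell_index \<beta> n)" using marked by blast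
  then have "(L (prod_encode (n, cell_index \<beta> n)), U (prod_encode (n, cell_index \<beta> n))) \<in> S i"
    unfolding S_def D_def by (intro CollectI exI[of _ "prod_encode (n, cell_index \<beta> n)"]) simp
  then have "\<beta> \<notin> cell n (cell_index \<beta> n)"
    using i unfolding cell_def by (force simp: L U)
  then show False using index(1) \<beta> by simp
qed

section \<open>Busy periods of a queue\<close>

lemma fmeasurable_intervals:
  "{a<..<b::real} \<in> fmeasurable lborel" "{a..<b::real} \<in> fmeasurable lborel" "{a<..b::real} \<in> fmeasurable lborel"
  by (cases "a \<le> b"; auto intro!: fmeasurableI)+

lemma measure_Un_disjoint:
  "A \<in> fmeasurable M \<Longrightarrow> B \<in> fmeasurable M \<Longrightarrow> A \<inter> B = {} \<Longrightarrow> measure M (A \<union> B) = measure M A + measure M B"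
  using measure_Union[of M A B] by (simp add: fmeasurableD fmeasurableD2)

text \<open>Let \<open>W\<close> be the amount of work that has arrived at a server by a given time, and let every unit of
  work take the time \<open>\<delta>\<close>. At time \<open>x\<close> the server is still busy with work that arrived in the time
  from \<open>r\<close> to \<open>s < x\<close> if \<open>x - r < \<delta> * (W s - W r)\<close>. The set of all such \<open>x\<close> is what the points of
  \<open>F\<close> reveal about the busy times.\<close>

definition busy :: "real \<Rightarrow> (rat \<Rightarrow> real) \<Rightarrow> rat set \<Rightarrow> real set" where
  "busy \<delta> W F = (\<Union>r\<in>F. \<Union>s\<in>{s \<in> F. r < s}. {of_rat s<..<of_rat r + \<delta> * (W s - W r)})"

lemma fmeasurable_busy: "finite F \<Longrightarrow> busy \<delta> W F \<in> fmeasurable lborel"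
  unfolding busy_def by (intro fmeasurable.finite_UN fmeasurable_intervals) auto

text \<open>A server cannot be busy for longer than its total work takes. Adding an arrival time \<open>z\<close> after all
  others prolongs the busy time by at most the time needed for the work that is new at \<open>z\<close>: the
  moment \<open>M\<close> when the old work is finished is delayed by that amount, and up to \<open>M\<close> the server was
  busy anyway. The bound has no covering constant in front of it, which is essential, since it will
  be used with a ratio of work to length just below \<open>1 / \<delta>\<close>.\<close>

lemma measure_busy_le:
  assumes "finite F" "0 \<le> \<delta>"
    and mono: "\<And>r s. r \<in> F \<Longrightarrow> s \<in> F \<Longrightarrow> r \<le> s \<Longrightarrow> W r \<le> W s"
    and bounds: "\<And>r. r \<in> F \<Longrightarrow> lo \<le> W r" "\<And>r. r \<in> F \<Longrightarrow> W r \<le> hi" and "lo \<le> hi"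
  shows "measure lborel (busy \<delta> W F) \<le> \<delta> * (hi - lo)"
proof (cases "F = {}")
  case True
  then show ?thesis using assms by (simp add: busy_def)
next
  case False
  have "F \<noteq> {} \<longrightarrow> measure lborel (busy \<delta> W F) \<le> \<delta> * (W (Max F) - lo)"
    using \<open>finite F\<close> mono bounds(1)
  proof (induction rule: finite_linorder_max_induct)
    case (insert z F)
    show ?case
    proof (cases "F = {}")
      case True
      then have "busy \<delta> W (insert z F) = {}" by (auto simp: busy_def)
      then show ?thesis using True insert.prems(2)[of z] \<open>0 \<le> \<delta>\<close> by simp
    next
      case False
      define y where "y = Max F"
      have y: "y \<in> F" "\<And>r. r \<in> F \<Longrightarrow> r \<le> y" using insert(1) False by (auto simp: y_def)
      \<comment> \<open>The start \<open>r0\<close> of the period that ends last does not depend on the final amount of work.\<close>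
      have "\<exists>r0\<in>F. \<forall>r\<in>F. of_rat r - \<delta> * W r \<le> of_rat r0 - \<delta> * W r0"
      proof -
        have "Max ((\<lambda>r. of_rat r - \<delta> * W r) ` F) \<in> (\<lambda>r. of_rat r - \<delta> * W r) ` F"
          using insert(1) False by (intro Max_in) auto
        then obtain r0 where "r0 \<in> F" and r0: "Max ((\<lambda>r. of_rat r - \<delta> * W r) ` F) = of_rat r0 - \<delta> * W r0"
          by blast
        then show ?thesis using insert(1) by (intro bexI[of _ r0]) (auto simp: r0[symmetric])
      qed
      then obtain r0 where r0: "r0 \<in> F" "\<And>r. r \<in> F \<Longrightarrow> of_rat r - \<delta> * W r \<le> of_rat r0 - \<delta> * W r0"
        by blast
      define M where "M = of_rat r0 + \<delta> * (W y - W r0)"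
      have "busy \<delta> W (insert z F) \<subseteq> busy \<delta> W F \<union> {M..<M + \<delta> * (W z - W y)}"
      proof
        fix x assume "x \<in> busy \<delta> W (insert z F)"
        then obtain r s where r: "r \<in> insert z F" and s: "s \<in> insert z F" and "r < s"
          and x: "of_rat s < x" "x < of_rat r + \<delta> * (W s - W r)"
          unfolding busy_def by auto
        have rF: "r \<in> F" using r s \<open>r < s\<close> insert(2) by auto
        show "x \<in> busy \<delta> W F \<union> {M..<M + \<delta> * (W z - W y)}"
        proof (cases "s = z")
          case True
          have "x < M + \<delta> * (W z - W y)"
            using x(2) r0(2)[OF rF] unfolding M_def True by (simp add: algebra_simps)
          moreover have "x \<in> busy \<delta> W F" if "x < M"
          proof -
            have yx: "of_rat y < x" using x(1) insert(2)[rule_format, OF y(1)] True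
              by (meson less_trans of_rat_less)
            then have "r0 \<noteq> y" using that by (auto simp: M_def)
            then have "r0 < y" using y(2)[OF r0(1)] by simp
            then show ?thesis using r0(1) y(1) yx that unfolding busy_def M_def by auto
          qed
          ultimately show ?thesis by (cases "x < M") auto
        next
          case False
          then show ?thesis using rF s \<open>r < s\<close> x unfolding busy_def by auto
        qed
      qed
      then have "measure lborel (busy \<delta> W (insert z F)) \<le>
          measure lborel (busy \<delta> W F \<union> {M..<M + \<delta> * (W z - W y)})"
        using insert(1) by (intro measure_mono_fmeasurable fmeasurable.Un fmeasurable_busy fmeasurable_intervals fmeasurableD) auto
      also have "\<dots> \<le> measure lborel (busy \<delta> W F) + measure lborel {M..<M + \<delta> * (W z - W y)}"
        using insert(1) by (intro measure_Un_le fmeasurableD fmeasurable_busy fmeasurable_intervals)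
      also have "measure lborel {M..<M + \<delta> * (W z - W y)} = \<delta> * (W z - W y)"
        using insert.prems(1)[of y z] y insert(2) \<open>0 \<le> \<delta>\<close> by (simp add: less_imp_le)
      also have "measure lborel (busy \<delta> W F) \<le> \<delta> * (W y - lo)"
        using insert False by (simp add: y_def)
      finally have "measure lborel (busy \<delta> W (insert z F)) \<le> \<delta> * (W z - lo)" by (simp add: algebra_simps)
      moreover have "Max (insert z F) = z"
        using insert(1,2) by (intro Max_eqI) (auto intro: less_imp_le)
      ultimately show ?thesis by simp
    qed
  qed simp
  moreover have "\<delta> * (W (Max F) - lo) \<le> \<delta> * (hi - lo)"
    using False assms by (intro mult_left_mono) auto
  ultimately show ?thesis using False by linarith
qed

text \<open>To bound the union of the predicted intervals of selected pairs only, it suffices to have an arrival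
  function \<open>W\<close> that grows as much as \<open>h\<close> across the selected pairs but may be constant elsewhere.\<close>

lemma measure_service_le:
  fixes T :: "(rat \<times> rat) set"
  assumes "finite T" "0 \<le> \<delta>" "lo \<le> hi"
    and T: "\<And>r s. (r, s) \<in> T \<Longrightarrow> r < s \<and> W s - W r = h s - h r"
    and mono: "\<And>r s. r \<in> fst ` T \<union> snd ` T \<Longrightarrow> s \<in> fst ` T \<union> snd ` T \<Longrightarrow> r \<le> s \<Longrightarrow> W r \<le> W s"
    and bounds: "\<And>r. r \<in> fst ` T \<union> snd ` T \<Longrightarrow> lo \<le> W r \<and> W r \<le> hi"
  shows "measure lborel (\<Union>(r, s)\<in>T. {of_rat s<..<of_rat r + \<delta> * (h s - h r)}) \<le> \<delta> * (hi - lo)"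
proof -
  let ?F = "fst ` T \<union> snd ` T"
  have "(\<Union>(r, s)\<in>T. {of_rat s<..<of_rat r + \<delta> * (h s - h r)}) \<subseteq> busy \<delta> W ?F"
  proof safe
    fix r s x assume rs: "(r, s) \<in> T" and x: "x \<in> {of_rat s<..<of_rat r + \<delta> * (h s - h r)}"
    have "r \<in> ?F" "s \<in> {s \<in> ?F. r < s}" using rs T[OF rs] by (force simp: image_iff)+
    moreover have "x \<in> {of_rat s<..<of_rat r + \<delta> * (W s - W r)}" using x T[OF rs] by simp
    ultimately show "x \<in> busy \<delta> W ?F" unfolding busy_def by blast
  qed
  then have "measure lborel (\<Union>(r, s)\<in>T. {of_rat s<..<of_rat r + \<delta> * (h s - h r)}) \<le> measure lborel (busy \<delta> W ?F)"
    using \<open>finite T\<close> by (intro measure_mono_fmeasurable fmeasurable_busy) auto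
  also have "\<dots> \<le> \<delta> * (hi - lo)"
    using assms by (intro measure_busy_le) auto
  finally show ?thesis .
qed

lemma measure_service_clipped_le:
  fixes T :: "(rat \<times> rat) set"
  assumes "finite T" "0 \<le> \<delta>" "lo \<le> hi"
    and T: "\<And>r s. (r, s) \<in> T \<Longrightarrow> r < s \<and> lo \<le> h r \<and> h r \<le> h s \<and> h s \<le> hi"
    and mono: "\<And>r s. r \<in> fst ` T \<union> snd ` T \<Longrightarrow> s \<in> fst ` T \<union> snd ` T \<Longrightarrow> r \<le> s \<Longrightarrow> h r \<le> h s"
  shows "measure lborel (\<Union>(r, s)\<in>T. {of_rat s<..<of_rat r + \<delta> * (h s - h r)}) \<le> \<delta> * (hi - lo)"
  using assms(1-3)
proof (rule measure_service_le[where W = h])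
  show "lo \<le> h r \<and> h r \<le> hi" if "r \<in> fst ` T \<union> snd ` T" for r using that T by fastforce
qed (use T mono in auto)

text \<open>A pair \<open>(r, s)\<close> is selected if some earlier \<open>p\<close> satisfies \<open>h s - h p \<le> c * (r - p)\<close>. The work
  arriving across selected pairs is then at most \<open>c\<close> times the length of the whole interval,
  although work outside of selected pairs may be arbitrarily large. The reason: let \<open>W u\<close> be the
  measure of the values up to \<open>h u\<close> that are passed across selected pairs. If \<open>u\<close> lies in the
  selected pair \<open>(r, s)\<close>, then \<open>W u \<le> W p + (h u - h p) \<le> c * (p - a) + c * (r - p) \<le> c * (u - a)\<close>
  by induction from left to right; if \<open>u\<close> lies in no selected pair, \<open>W\<close> has not grown since the end
  of the last one. It matters that the selection compares with \<open>r\<close> and not with a later point: only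
  then the inequality is inherited by all \<open>u\<close> between \<open>r\<close> and \<open>s\<close>, including those discovered after
  the pair was selected.\<close>

lemma measure_service_oscillation_le:
  fixes T :: "(rat \<times> rat) set" and a b :: rat
  assumes "finite T" "0 \<le> \<delta>" "0 \<le> c" "a \<le> b"
    and T: "\<And>r s. (r, s) \<in> T \<Longrightarrow> \<exists>p\<in>D. r \<in> D \<and> s \<in> D \<and> a \<le> p \<and> p < r \<and> r < s \<and> s \<le> b \<and>
      h s - h p \<le> c * of_rat (r - p)"
    and mono: "\<And>r s. r \<in> D \<Longrightarrow> s \<in> D \<Longrightarrow> r \<le> s \<Longrightarrow> h r \<le> h s"
  shows "measure lborel (\<Union>(r, s)\<in>T. {of_rat s<..<of_rat r + \<delta> * (h s - h r)}) \<le> \<delta> * (c * of_rat (b - a))"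
proof -
  have "\<forall>x\<in>T. \<exists>p\<in>D. fst x \<in> D \<and> snd x \<in> D \<and> a \<le> p \<and> p < fst x \<and> fst x < snd x \<and> snd x \<le> b \<and>
      h (snd x) - h p \<le> c * of_rat (fst x - p)" using T by auto
  then obtain P where P: "\<And>x. x \<in> T \<Longrightarrow> P x \<in> D \<and> fst x \<in> D \<and> snd x \<in> D \<and> a \<le> P x \<and> P x < fst x \<and>
      fst x < snd x \<and> snd x \<le> b \<and> h (snd x) - h (P x) \<le> c * of_rat (fst x - P x)"
    by metis
  define F where "F = P ` T \<union> fst ` T \<union> snd ` T"
  have F: "finite F" "F \<subseteq> D" "\<And>u. u \<in> F \<Longrightarrow> a \<le> u \<and> u \<le> b"
    using \<open>finite T\<close> P unfolding F_def by (auto, fastforce+)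
  \<comment> \<open>Measuring the set of values makes work that is claimed by several pairs count once.\<close>
  define \<Lambda> where "\<Lambda> = (\<Union>(r, s)\<in>T. {h r<..h s})"
  define W where "W u = measure lborel (\<Lambda> \<inter> {..h u})" for u
  have \<Lambda>_meas: "\<Lambda> \<in> fmeasurable lborel"
    unfolding \<Lambda>_def using \<open>finite T\<close> by (intro fmeasurable.finite_UN) (auto simp: fmeasurable_intervals)
  have meas: "\<Lambda> \<inter> {..t} \<in> fmeasurable lborel" for t
    by (intro fmeasurable_Int_fmeasurable[OF \<Lambda>_meas]) simp
  have W_mono: "W u \<le> W v" if "\<Lambda> \<inter> {..h u} \<subseteq> {..h v}" for u v
    unfolding W_def using that by (intro measure_mono_fmeasurable meas fmeasurableD) auto
  have W_diff: "W s - W r = h s - h r" if "(r, s) \<in> T" for r s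
  proof -
    have "h r \<le> h s" using P[OF that] mono by (simp add: less_imp_le)
    have "\<Lambda> \<inter> {..h s} = (\<Lambda> \<inter> {..h r}) \<union> {h r<..h s}"
      using that \<open>h r \<le> h s\<close> unfolding \<Lambda>_def by auto
    then have "W s = W r + measure lborel {h r<..h s}"
      unfolding W_def by (simp only:) (rule measure_Un_disjoint[OF meas fmeasurable_intervals(3)], auto)
    then show ?thesis using \<open>h r \<le> h s\<close> by simp
  qed
  have W_step: "W u \<le> W p + (h u - h p)" if "h p \<le> h u" for u p
  proof -
    have "W u \<le> measure lborel ((\<Lambda> \<inter> {..h p}) \<union> {h p<..h u})"
      unfolding W_def by (intro measure_mono_fmeasurable fmeasurable.Un meas fmeasurable_intervals fmeasurableD) auto
    also have "\<dots> \<le> W p + measure lborel {h p<..h u}"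
      unfolding W_def by (intro measure_Un_le fmeasurableD meas fmeasurable_intervals)
    finally show ?thesis using that by simp
  qed
  have W_le: "W u \<le> c * of_rat (u - a)" if "u \<in> F" for u
  proof (rule ccontr)
    define B where "B = {u \<in> F. \<not> W u \<le> c * of_rat (u - a)}"
    assume "\<not> W u \<le> c * of_rat (u - a)"
    then have B: "finite B" "B \<noteq> {}" using F(1) that by (auto simp: B_def)
    define v where "v = Min B"
    have v: "v \<in> F" "\<not> W v \<le> c * of_rat (v - a)" using Min_in[OF B] by (auto simp: v_def B_def)
    have IH: "W u \<le> c * of_rat (u - a)" if "u \<in> F" "u < v" for u
    proof (rule ccontr)
      assume "\<not> ?thesis"
      then have "u \<in> B" using that by (simp add: B_def)
      then have "v \<le> u" using Min_le[OF B(1)] by (simp add: v_def)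
      then show False using that by simp
    qed
    have le: "c * of_rat u \<le> c * of_rat w" if "u \<le> w" for u w :: rat
      using that \<open>0 \<le> c\<close> by (intro mult_left_mono) (auto simp: of_rat_less_eq)
    show False
    proof (cases "\<exists>x\<in>T. fst x < v \<and> v \<le> snd x")
      case True
      then obtain x where x: "x \<in> T" "fst x < v" "v \<le> snd x" by blast
      let ?p = "P x"
      have p: "?p \<in> F" "?p < v" using P[OF x(1)] x by (auto simp: F_def)
      have "W v \<le> W ?p + (h v - h ?p)"
        using W_step mono[of ?p v] p v(1) F(2) by auto
      moreover have "W ?p \<le> c * of_rat (?p - a)" by (rule IH[OF p])
      moreover have "h v \<le> h (snd x)" using mono[of v "snd x"] P[OF x(1)] v(1) F(2) x(3) by auto
      moreover have "h (snd x) - h ?p \<le> c * of_rat (fst x - ?p)" using P[OF x(1)] by blast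
      moreover have "c * of_rat (?p - a) + c * of_rat (fst x - ?p) \<le> c * of_rat (v - a)"
        using le[of "fst x" v] x(2) by (simp add: of_rat_diff algebra_simps)
      ultimately show False using v(2) by linarith
    next
      case False
      define B' where "B' = {s \<in> snd ` T. s < v}"
      have \<Lambda>: "\<exists>s\<in>B'. t \<le> h s" if t: "t \<in> \<Lambda>" "t \<le> h v" for t
      proof -
        obtain r s where rs: "(r, s) \<in> T" "h r < t" "t \<le> h s" using t(1) unfolding \<Lambda>_def by auto
        have "r < v"
        proof (rule ccontr)
          assume "\<not> r < v"
          then have "h v \<le> h r" using mono[of v r] P[OF rs(1)] v(1) F(2) by auto
          then show False using rs(2) t(2) by simp
        qed
        then have "s < v" using False rs(1) by force
        then show ?thesis using rs unfolding B'_def by force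
      qed
      show False
      proof (cases "B' = {}")
        case True
        then have "\<Lambda> \<inter> {..h v} = {}" using \<Lambda> by auto
        then have "W v = 0" by (simp add: W_def)
        moreover have "0 \<le> c * of_rat (v - a)" using le[of a v] F(3)[OF v(1)] by (simp add: of_rat_diff algebra_simps)
        ultimately show False using v(2) by simp
      next
        case nonempty: False
        define s where "s = Max B'"
        have fin: "finite B'" using \<open>finite T\<close> by (simp add: B'_def)
        have s: "s \<in> snd ` T" "s < v" using Max_in[OF fin nonempty] by (auto simp: s_def B'_def)
        have "\<Lambda> \<inter> {..h v} \<subseteq> {..h s}"
        proof
          fix t assume "t \<in> \<Lambda> \<inter> {..h v}"
          then obtain s' where s': "s' \<in> B'" "t \<le> h s'" using \<Lambda> by auto
          moreover have "snd ` T \<subseteq> D" using P by auto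
          then have "s' \<in> D" "s \<in> D" using s'(1) s(1) unfolding B'_def by blast+
          then have "h s' \<le> h s"
            using Max_ge[OF fin s'(1)] unfolding s_def[symmetric] by (intro mono)
          ultimately show "t \<in> {..h s}" by simp
        qed
        then have "W v \<le> W s" by (rule W_mono)
        also have "W s \<le> c * of_rat (s - a)" using s by (intro IH) (auto simp: F_def)
        also have "\<dots> \<le> c * of_rat (v - a)" using le[of s v] s(2) by (simp add: of_rat_diff algebra_simps)
        finally show False using v(2) by simp
      qed
    qed
  qed
  have "measure lborel (\<Union>(r, s)\<in>T. {of_rat s<..<of_rat r + \<delta> * (h s - h r)}) \<le> \<delta> * (c * of_rat (b - a) - 0)"
  proof (rule measure_service_le[where W = W])
    show "0 \<le> c * of_rat (b - a)" using assms(3,4) by (simp add: of_rat_less_eq[of 0, simplified])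
    show "r < s \<and> W s - W r = h s - h r" if "(r, s) \<in> T" for r s using W_diff[OF that] P[OF that] by simp
    fix r assume r: "r \<in> fst ` T \<union> snd ` T"
    then have rF: "r \<in> F" by (auto simp: F_def)
    have "c * of_rat (r - a) \<le> c * of_rat (b - a)"
      using F(3)[OF rF] assms(3) by (intro mult_left_mono) (auto simp: of_rat_less_eq)
    then show "0 \<le> W r \<and> W r \<le> c * of_rat (b - a)" using W_le[OF rF] by (simp add: W_def)
    fix s assume s: "s \<in> fst ` T \<union> snd ` T" "r \<le> s"
    then have "s \<in> F" by (auto simp: F_def)
    then have "h r \<le> h s" using mono[of r s] F(2) rF s(2) by blast
    then show "W r \<le> W s" by (intro W_mono) auto
  qed (use assms in auto)
  then show ?thesis by simp
qed

section \<open>Covers by predicted busy intervals\<close>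

lemma partial_computable_rat_stages:
  assumes "partial_computable_rat g"
  obtains F where "recursive F"
    and "\<And>p t. F (prod_encode (p, t)) \<noteq> 0 \<Longrightarrow>
      g (nat_to_rat_surj p) = Some (nat_to_rat_surj (F (prod_encode (p, t)) - 1))"
    and "\<And>p u. g (nat_to_rat_surj p) = Some u \<Longrightarrow> \<exists>t0. \<forall>t\<ge>t0. F (prod_encode (p, t)) \<noteq> 0"
proof -
  obtain f where f: "partial_recursive f" "\<And>n. map_option nat_to_rat_surj (f n) = g (nat_to_rat_surj n)"
    using assms unfolding partial_computable_rat_def by blast
  obtain F where F: "staged f F" using partial_recursive_staged[OF f(1)] by blast
  show thesis
  proof (rule that[of F])
    show "recursive F" by (rule stagedD(1)[OF F])
    show "g (nat_to_rat_surj p) = Some (nat_to_rat_surj (F (prod_encode (p, t)) - 1))"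
      if nz: "F (prod_encode (p, t)) \<noteq> 0" for p t
    proof -
      obtain v where v: "F (prod_encode (p, t)) = Suc v" using not0_implies_Suc[OF nz] ..
      then have "f p = Some v" using stagedD(3)[OF F, of p v] by auto
      then show ?thesis using f(2)[of p] v by simp
    qed
    show "\<exists>t0. \<forall>t\<ge>t0. F (prod_encode (p, t)) \<noteq> 0" if u: "g (nat_to_rat_surj p) = Some u" for p u
    proof -
      obtain v where "f p = Some v" using f(2)[of p] u by (cases "f p") auto
      then obtain t0 where t0: "F (prod_encode (p, t0)) = Suc v" using stagedD(3)[OF F, of p v] by auto
      have "F (prod_encode (p, t)) \<noteq> 0" if "t0 \<le> t" for t
        using stagedD(2)[OF F t0 that] by simp
      then show ?thesis by blast
    qed
  qed
qed

text \<open>A witness \<open>(p, r, s)\<close> with the values \<open>g p\<close>, \<open>h r\<close>, \<open>h s\<close> predicts, using only points left of \<open>\<beta>\<close>,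
  that \<open>\<beta>\<close> lies between \<open>s\<close> and \<open>r + \<delta> m * (h s - h r)\<close>, where \<open>m\<close> is the level of the cell under
  consideration. If an acceptable witness exists in every cell around \<open>\<beta>\<close>, while the predictions in
  a cell together have at most the fraction \<open>\<kappa>\<close> of its measure, then \<open>\<beta>\<close> is not random. A smaller
  cell is put into the cover if a witness with a code up to the level of that cell predicts an
  interval around it; this makes the relation between cells decidable.\<close>

lemma not_random_if_triples_cover:
  fixes \<beta> \<kappa> :: real and g h :: "rat \<rightharpoonup> rat" and \<delta> :: "nat \<Rightarrow> rat"
    and Cond :: "nat \<Rightarrow> nat \<Rightarrow> rat \<Rightarrow> rat \<Rightarrow> rat \<Rightarrow> rat \<Rightarrow> rat \<Rightarrow> rat \<Rightarrow> bool"
  assumes \<beta>: "\<beta> \<in> {0..<1}" and \<kappa>: "0 \<le> \<kappa>" "\<kappa> < 1"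
    and g: "partial_computable_rat g" and h: "partial_computable_rat h"
    and Cond: "\<And>M I P R S U V W. recursive M \<Longrightarrow> recursive I \<Longrightarrow> recursive_rat P \<Longrightarrow> recursive_rat R \<Longrightarrow> recursive_rat S \<Longrightarrow>
      recursive_rat U \<Longrightarrow> recursive_rat V \<Longrightarrow> recursive_rat W \<Longrightarrow>
      decidable (\<lambda>x. Cond (M x) (I x) (P x) (R x) (S x) (U x) (V x) (W x))"
    and \<delta>: "\<And>M. recursive M \<Longrightarrow> recursive_rat (\<lambda>x. \<delta> (M x))"
    and measure_le: "\<And>m i T. i < 2 ^ m \<Longrightarrow> finite T \<Longrightarrow>
      (\<And>r s. (r, s) \<in> T \<Longrightarrow> \<exists>p u v w. g p = Some u \<and> h r = Some v \<and> h s = Some w \<and> Cond m i p r s u v w) \<Longrightarrow>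
      measure lborel (\<Union>(r, s)\<in>T. {of_rat s<..<of_rat r + of_rat (\<delta> m) * (of_rat (the (h s)) - of_rat (the (h r)) :: real)})
        \<le> \<kappa> / 2 ^ m"
    and cover: "\<And>m i. i < 2 ^ m \<Longrightarrow> \<beta> \<in> cell m i \<Longrightarrow>
      \<exists>p r s u v w. g p = Some u \<and> h r = Some v \<and> h s = Some w \<and> Cond m i p r s u v w \<and>
        of_rat s < \<beta> \<and> \<beta> < of_rat r + of_rat (\<delta> m) * (of_rat w - of_rat v)"
  shows "\<not> martin_loef_random \<beta>"
proof -
  obtain F where F: "recursive F"
    "\<And>p t. F (prod_encode (p, t)) \<noteq> 0 \<Longrightarrow> g (nat_to_rat_surj p) = Some (nat_to_rat_surj (F (prod_encode (p, t)) - 1))"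
    "\<And>p u. g (nat_to_rat_surj p) = Some u \<Longrightarrow> \<exists>t0. \<forall>t\<ge>t0. F (prod_encode (p, t)) \<noteq> 0"
    using partial_computable_rat_stages[OF g] by blast
  obtain H where H: "recursive H"
    "\<And>p t. H (prod_encode (p, t)) \<noteq> 0 \<Longrightarrow> h (nat_to_rat_surj p) = Some (nat_to_rat_surj (H (prod_encode (p, t)) - 1))"
    "\<And>p u. h (nat_to_rat_surj p) = Some u \<Longrightarrow> \<exists>t0. \<forall>t\<ge>t0. H (prod_encode (p, t)) \<noteq> 0"
    using partial_computable_rat_stages[OF h] by blast
  define cp where "cp z = fst (prod_decode (fst (prod_decode z)))" for z
  define cr where "cr z = snd (prod_decode (fst (prod_decode z)))" for z
  define cs where "cs z = fst (prod_decode (snd (prod_decode z)))" for z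
  define ct where "ct z = snd (prod_decode (snd (prod_decode z)))" for z
  define Fp where "Fp z = F (prod_encode (cp z, ct z))" for z
  define Hr where "Hr z = H (prod_encode (cr z, ct z))" for z
  define Hs where "Hs z = H (prod_encode (cs z, ct z))" for z
  define right where "right m z = nat_to_rat_surj (cr z) +
    \<delta> m * (nat_to_rat_surj (Hs z - 1) - nat_to_rat_surj (Hr z - 1))" for m z
  define V where "V m i z \<longleftrightarrow> Fp z \<noteq> 0 \<and> Hr z \<noteq> 0 \<and> Hs z \<noteq> 0 \<and>
    Cond m i (nat_to_rat_surj (cp z)) (nat_to_rat_surj (cr z)) (nat_to_rat_surj (cs z))
      (nat_to_rat_surj (Fp z - 1)) (nat_to_rat_surj (Hr z - 1)) (nat_to_rat_surj (Hs z - 1))" for m i z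
  define G where "G m i n k \<longleftrightarrow> (\<exists>z\<le>n. V m i z \<and> nat_to_rat_surj (cs z) \<le> of_nat k / of_nat (2 ^ n) \<and>
    of_nat (k + 1) / of_nat (2 ^ n) \<le> right m z)" for m i n k
  define J where "J m r s = {of_rat s<..<of_rat r + of_rat (\<delta> m) * (of_rat (the (h s)) - of_rat (the (h r)) :: real)}"
    for m r s
  have V_values: "g (nat_to_rat_surj (cp z)) = Some (nat_to_rat_surj (Fp z - 1))"
    "h (nat_to_rat_surj (cr z)) = Some (nat_to_rat_surj (Hr z - 1))"
    "h (nat_to_rat_surj (cs z)) = Some (nat_to_rat_surj (Hs z - 1))" if "V m i z" for m i z
    using that F(2)[of "cp z" "ct z"] H(2)[of "cr z" "ct z"] H(2)[of "cs z" "ct z"]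
    unfolding V_def Fp_def Hr_def Hs_def by auto
  have J: "J m (nat_to_rat_surj (cr z)) (nat_to_rat_surj (cs z)) = {of_rat (nat_to_rat_surj (cs z))<..<of_rat (right m z)}"
    if "V m i z" for m i z
    unfolding J_def right_def using V_values[OF that] by (simp add: of_rat_add of_rat_mult of_rat_diff)
  have cell_iff: "nat_to_rat_surj (cs z) \<le> of_nat k / of_nat (2 ^ n) \<longleftrightarrow> of_rat (nat_to_rat_surj (cs z)) \<le> real k / 2 ^ n"
    "of_nat (k + 1) / of_nat (2 ^ n) \<le> right m z \<longleftrightarrow> (real k + 1) / 2 ^ n \<le> of_rat (right m z)" for m z k n
    by (simp_all add: of_rat_less_eq[where 'a = real, symmetric] of_rat_divide of_rat_power of_rat_add add.commute)
  show ?thesis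
  proof (rule not_random_if_nested_cover[where G = G, OF \<beta> \<kappa>])
    fix M I N K assume rec: "recursive M" "recursive I" "recursive N" "recursive K"
    note rec' = recursive_intros recursive_rat_intros recursive_compose[OF rec(1)] recursive_compose[OF rec(2)] recursive_compose[OF rec(3)]
      recursive_compose[OF rec(4)] recursive_compose[OF F(1)] recursive_compose[OF H(1)]
    show "decidable (\<lambda>x. G (M x) (I x) (N x) (K x))"
      unfolding G_def V_def right_def Fp_def Hr_def Hs_def cp_def cr_def cs_def ct_def
      by (intro rec' rec \<delta> Cond)
  next
    fix m i W
    assume i: "i < 2 ^ m" and W: "finite W" "disjoint_cells W"
      and G: "\<And>n k. (n, k) \<in> W \<Longrightarrow> m < n \<and> k div 2 ^ (n - m) = i \<and> G m i n k"
    have "\<exists>z. V m i z \<and> cell (fst x) (snd x) \<subseteq> J m (nat_to_rat_surj (cr z)) (nat_to_rat_surj (cs z))"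
      if "x \<in> W" for x
    proof -
      have "G m i (fst x) (snd x)" using G[of "fst x" "snd x"] that by simp
      then obtain z where z: "V m i z" "of_rat (nat_to_rat_surj (cs z)) \<le> real (snd x) / 2 ^ fst x"
        "(real (snd x) + 1) / 2 ^ fst x \<le> of_rat (right m z)"
        unfolding G_def cell_iff by blast
      have "cell (fst x) (snd x) \<subseteq> J m (nat_to_rat_surj (cr z)) (nat_to_rat_surj (cs z))"
        unfolding J[OF z(1)] cell_def using z(2,3) by auto
      then show ?thesis using z(1) by blast
    qed
    then obtain z where z: "\<And>x. x \<in> W \<Longrightarrow> V m i (z x)"
      "\<And>x. x \<in> W \<Longrightarrow> cell (fst x) (snd x) \<subseteq> J m (nat_to_rat_surj (cr (z x))) (nat_to_rat_surj (cs (z x)))"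
      by metis
    define T where "T = (\<lambda>x. (nat_to_rat_surj (cr (z x)), nat_to_rat_surj (cs (z x)))) ` W"
    have "(\<Sum>(n, k)\<in>W. 1 / 2 ^ n) = (\<Sum>x\<in>W. measure lborel (cell (fst x) (snd x)))"
      by (simp add: measure_cell split_beta)
    also have "\<dots> = measure lborel (\<Union>x\<in>W. cell (fst x) (snd x))"
    proof (rule measure_finite_Union[symmetric])
      show "disjoint_family_on (\<lambda>x. cell (fst x) (snd x)) W"
        using W(2) unfolding disjoint_cells_def pairwise_def split_beta disjoint_family_on_def by blast
      show "emeasure lborel (cell (fst x) (snd x)) \<noteq> \<infinity>" for x
        using fmeasurableD2[OF fmeasurable_intervals(1)] by (simp add: cell_def)
    qed (use W in \<open>auto simp: cell_def\<close>)
    also have "\<dots> \<le> measure lborel (\<Union>(r, s)\<in>T. J m r s)"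
    proof (rule measure_mono_fmeasurable)
      show "(\<Union>x\<in>W. cell (fst x) (snd x)) \<subseteq> (\<Union>(r, s)\<in>T. J m r s)" using z(2) by (force simp: T_def)
      show "(\<Union>x\<in>W. cell (fst x) (snd x)) \<in> sets lborel" using W(1) by (auto simp: cell_def)
      show "(\<Union>(r, s)\<in>T. J m r s) \<in> fmeasurable lborel"
        using W(1) by (intro fmeasurable.finite_UN) (auto simp: T_def J_def fmeasurable_intervals)
    qed
    also have "\<dots> \<le> \<kappa> / 2 ^ m"
      unfolding J_def
    proof (rule measure_le[OF i])
      show "finite T" using W(1) by (simp add: T_def)
      fix r s assume "(r, s) \<in> T"
      then obtain x where x: "x \<in> W" "r = nat_to_rat_surj (cr (z x))" "s = nat_to_rat_surj (cs (z x))"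
        by (auto simp: T_def)
      show "\<exists>p u v w. g p = Some u \<and> h r = Some v \<and> h s = Some w \<and> Cond m i p r s u v w"
        using V_values[OF z(1)[OF x(1)]] z(1)[OF x(1)] unfolding x V_def by blast
    qed
    finally show "(\<Sum>(n, k)\<in>W. 1 / 2 ^ n) \<le> \<kappa> / 2 ^ m" .
  next
    fix m i assume i: "i < 2 ^ m" "\<beta> \<in> cell m i"
    obtain p r s u v w where prs: "g p = Some u" "h r = Some v" "h s = Some w" "Cond m i p r s u v w"
      and J\<beta>: "of_rat s < \<beta>" "\<beta> < of_rat r + of_rat (\<delta> m) * (of_rat w - of_rat v)"
      using cover[OF i] by blast
    obtain a b c where abc: "p = nat_to_rat_surj a" "r = nat_to_rat_surj b" "s = nat_to_rat_surj c"
      using surj_nat_to_rat_surj by (metis surjD)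
    obtain t1 t2 t3 where t: "\<And>t. t1 \<le> t \<Longrightarrow> F (prod_encode (a, t)) \<noteq> 0"
      "\<And>t. t2 \<le> t \<Longrightarrow> H (prod_encode (b, t)) \<noteq> 0" "\<And>t. t3 \<le> t \<Longrightarrow> H (prod_encode (c, t)) \<noteq> 0"
      using F(3)[of a u] H(3)[of b v] H(3)[of c w] prs unfolding abc by blast
    define z where "z = prod_encode (prod_encode (a, b), prod_encode (c, t1 + t2 + t3))"
    have z: "cp z = a" "cr z = b" "cs z = c" "ct z = t1 + t2 + t3"
      by (simp_all add: z_def cp_def cr_def cs_def ct_def)
    have nz: "Fp z \<noteq> 0" "Hr z \<noteq> 0" "Hs z \<noteq> 0" unfolding Fp_def Hr_def Hs_def z by (simp_all add: t)
    have vals: "nat_to_rat_surj (Fp z - 1) = u" "nat_to_rat_surj (Hr z - 1) = v" "nat_to_rat_surj (Hs z - 1) = w"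
      using F(2)[of a "ct z"] H(2)[of b "ct z"] H(2)[of c "ct z"] nz prs unfolding Fp_def Hr_def Hs_def z abc by auto
    have Vz: "V m i z" unfolding V_def vals using nz prs(4) unfolding z abc by blast
    have right: "of_rat (right m z) = of_rat r + of_rat (\<delta> m) * (of_rat w - of_rat v :: real)"
      unfolding right_def vals z abc by (simp add: of_rat_add of_rat_mult of_rat_diff)
    \<comment> \<open>Cells of this size around \<open>\<beta>\<close> fit into the predicted interval.\<close>
    obtain N0 where N0: "(1 / 2) ^ N0 < min (\<beta> - of_rat s) (of_rat (right m z) - \<beta>)"
      using real_arch_pow_inv[of "min (\<beta> - of_rat s) (of_rat (right m z) - \<beta>)" "1 / 2"] J\<beta> right by auto
    show "\<exists>N. \<forall>n k. N \<le> n \<longrightarrow> \<beta> \<in> cell n k \<longrightarrow> G m i n k"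
    proof (intro exI[of _ "max z N0"] allI impI)
      fix n k assume n: "max z N0 \<le> n" and \<beta>_cell: "\<beta> \<in> cell n k"
      have "(1 / 2 :: real) ^ n \<le> (1 / 2) ^ N0" using n by (intro power_decreasing) auto
      then have small: "1 / 2 ^ n < \<beta> - of_rat s" "1 / 2 ^ n < of_rat (right m z) - \<beta>"
        using N0 by (auto simp: power_one_over)
      have "real k / 2 ^ n < \<beta>" "\<beta> < real k / 2 ^ n + 1 / 2 ^ n"
        using \<beta>_cell by (auto simp: cell_def add_divide_distrib)
      then have "of_rat s \<le> real k / 2 ^ n" "(real k + 1) / 2 ^ n \<le> of_rat (right m z)"
        using small unfolding add_divide_distrib by linarith+
      then show "G m i n k"
        unfolding G_def cell_iff using Vz n z(3) abc(3) by (intro exI[of _ z]) auto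
    qed
  qed
qed

section \<open>Slopes of translation functions\<close>

lemma eventually_rat_at_left:
  "eventually P (rat_at_left \<beta>) \<longleftrightarrow> (\<exists>b<\<beta>. \<forall>q\<in>{0..<1}. b < of_rat q \<longrightarrow> of_rat q < \<beta> \<longrightarrow> P q)"
proof -
  have "eventually P (rat_at_left \<beta>) \<longleftrightarrow>
      (\<exists>Q. eventually Q (at_left \<beta>) \<and> (\<forall>q. Q (of_rat q) \<longrightarrow> q \<in> {0..<1} \<longrightarrow> P q))"
    unfolding rat_at_left_def eventually_inf_principal eventually_filtercomap by blast
  also have "\<dots> \<longleftrightarrow> (\<exists>b<\<beta>. \<forall>q\<in>{0..<1}. b < of_rat q \<longrightarrow> of_rat q < \<beta> \<longrightarrow> P q)"
  proof
    assume "\<exists>Q. eventually Q (at_left \<beta>) \<and> (\<forall>q. Q (of_rat q) \<longrightarrow> q \<in> {0..<1} \<longrightarrow> P q)"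
    then show "\<exists>b<\<beta>. \<forall>q\<in>{0..<1}. b < of_rat q \<longrightarrow> of_rat q < \<beta> \<longrightarrow> P q"
      unfolding eventually_at_left_field by blast
  next
    assume "\<exists>b<\<beta>. \<forall>q\<in>{0..<1}. b < of_rat q \<longrightarrow> of_rat q < \<beta> \<longrightarrow> P q"
    then obtain b where "b < \<beta>" "\<forall>q\<in>{0..<1}. b < of_rat q \<longrightarrow> of_rat q < \<beta> \<longrightarrow> P q" by blast
    then show "\<exists>Q. eventually Q (at_left \<beta>) \<and> (\<forall>q. Q (of_rat q) \<longrightarrow> q \<in> {0..<1} \<longrightarrow> P q)"
      by (intro exI[of _ "\<lambda>x. b < x \<and> x < \<beta>"]) (auto simp: eventually_at_left_field)
  qed
  finally show ?thesis .
qed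

lemma frequently_rat_at_left:
  "frequently P (rat_at_left \<beta>) \<longleftrightarrow> (\<forall>b<\<beta>. \<exists>q\<in>{0..<1}. b < of_rat q \<and> of_rat q < \<beta> \<and> P q)"
  unfolding frequently_def eventually_rat_at_left by blast

lemma rat_at_left_nontrivial:
  assumes "0 < \<beta>" "\<beta> \<le> 1"
  shows "rat_at_left \<beta> \<noteq> bot"
proof -
  have "\<exists>q\<in>{0..<1}. b < of_rat q \<and> of_rat q < \<beta> \<and> True" if "b < \<beta>" for b
  proof -
    have "max 0 b < \<beta>" using that assms(1) by simp
    then obtain q where q: "max 0 b < of_rat q" "of_rat q < \<beta>" using of_rat_dense by blast
    have "0 < (of_rat q :: real)" "of_rat q < (1 :: real)" using q assms by linarith+
    then show ?thesis using q by auto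
  qed
  then have "frequently (\<lambda>_. True) (rat_at_left \<beta>)" unfolding frequently_rat_at_left by blast
  then show ?thesis by (simp add: frequently_const_iff)
qed

definition slope :: "(rat \<rightharpoonup> rat) \<Rightarrow> real \<Rightarrow> real \<Rightarrow> rat \<Rightarrow> real" where
  "slope g \<beta> \<alpha> q = (\<alpha> - of_rat (the (g q))) / (\<beta> - of_rat q)"

lemma translation_value:
  assumes "translation_function g \<beta> \<alpha>" "q \<in> {0..<1}" "of_rat q < \<beta>"
  obtains v where "g q = Some v" "of_rat v < \<alpha>"
proof -
  have "\<exists>r. g q = Some r \<and> of_rat r < \<alpha>"
    using assms unfolding translation_function_def by (elim conjE) (drule (1) bspec, erule (1) mp)
  then show thesis using that by blast
qed

lemma slope_pos:
  assumes "translation_function g \<beta> \<alpha>" "q \<in> {0..<1}" "of_rat q < \<beta>"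
  shows "0 < slope g \<beta> \<alpha> q"
  by (rule translation_value[OF assms]) (use assms(3) in \<open>simp add: slope_def\<close>)

lemma eventually_slope_pos:
  "translation_function g \<beta> \<alpha> \<Longrightarrow> eventually (\<lambda>q. 0 < slope g \<beta> \<alpha> q) (rat_at_left \<beta>)"
  unfolding eventually_rat_at_left using slope_pos by (intro exI[of _ "\<beta> - 1"]) simp

lemma nondecreasing_values:
  assumes "nondecreasing h" "h r = Some v" "h s = Some w" "r \<le> s"
  shows "v \<le> w"
proof -
  have "r \<in> dom h" "s \<in> dom h" using assms(2,3) by auto
  then have "the (h r) \<le> the (h s)" using assms(1,4) unfolding nondecreasing_def by blast
  then show ?thesis by (simp add: assms(2,3))
qed

text \<open>If the slope at \<open>r\<close> exceeds \<open>d\<close>, then already the increment from \<open>r\<close> to a suitable \<open>s < \<beta>\<close> exceeds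
  \<open>d * (\<beta> - r)\<close>, because \<open>h\<close> tends to \<open>\<alpha>\<close>. This makes a steep slope, which refers to the unknown
  \<open>\<alpha>\<close>, visible in finitely many values of \<open>h\<close>.\<close>

lemma steep_increment:
  assumes h: "translation_function h \<beta> \<alpha>" and "0 < \<beta>" "\<beta> \<le> 1"
    and steep: "frequently (\<lambda>q. d < slope h \<beta> \<alpha> q) (rat_at_left \<beta>)"
    and "L < \<beta>" "y < \<alpha>"
  obtains r s v w where "0 \<le> r" "L < of_rat r" "r < s" "of_rat s < \<beta>" "h r = Some v" "h s = Some w"
    "y < of_rat v" "of_rat w < \<alpha>" "d * (\<beta> - of_rat r) < of_rat w - of_rat v"
proof -
  have lim: "((\<lambda>q. of_rat (the (h q))) \<longlongrightarrow> \<alpha>) (rat_at_left \<beta>)"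
    using h unfolding translation_function_def by blast
  have "eventually (\<lambda>q. L < of_rat q) (rat_at_left \<beta>)"
    unfolding eventually_rat_at_left using \<open>L < \<beta>\<close> by blast
  moreover have "eventually (\<lambda>q. y < of_rat (the (h q))) (rat_at_left \<beta>)"
    using lim \<open>y < \<alpha>\<close> by (rule order_tendstoD)
  ultimately have "eventually (\<lambda>q. L < of_rat q \<and> y < of_rat (the (h q))) (rat_at_left \<beta>)"
    by (rule eventually_conj)
  then have "frequently (\<lambda>q. d < slope h \<beta> \<alpha> q \<and> (L < of_rat q \<and> y < of_rat (the (h q)))) (rat_at_left \<beta>)"
    using steep by (intro frequently_eventually_frequently)
  moreover have "\<beta> - 1 < \<beta>" by simp
  ultimately obtain r where r: "r \<in> {0..<1}" "of_rat r < \<beta>" "d < slope h \<beta> \<alpha> r" "L < of_rat r" "y < of_rat (the (h r))"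
    unfolding frequently_rat_at_left by blast
  obtain v where v: "h r = Some v" "of_rat v < \<alpha>" using translation_value[OF h r(1,2)] .
  have "of_rat v + d * (\<beta> - of_rat r) < \<alpha>"
    using r(2,3) v by (simp add: slope_def pos_less_divide_eq)
  then have "eventually (\<lambda>q. of_rat v + d * (\<beta> - of_rat r) < of_rat (the (h q))) (rat_at_left \<beta>)"
    by (rule order_tendstoD(1)[OF lim])
  moreover have "frequently (\<lambda>_. True) (rat_at_left \<beta>)"
    using rat_at_left_nontrivial[OF assms(2,3)] by (simp add: frequently_const_iff)
  ultimately have "frequently (\<lambda>q. True \<and> of_rat v + d * (\<beta> - of_rat r) < of_rat (the (h q))) (rat_at_left \<beta>)"
    by (intro frequently_eventually_frequently)
  then obtain s where s: "s \<in> {0..<1}" "of_rat r < (of_rat s :: real)" "of_rat s < \<beta>"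
    "of_rat v + d * (\<beta> - of_rat r) < of_rat (the (h s))"
    unfolding frequently_rat_at_left using r(2) by blast
  obtain w where w: "h s = Some w" "of_rat w < \<alpha>" using translation_value[OF h s(1,3)] .
  show thesis
    by (rule that[of r s v w]) (use r s v w in \<open>auto simp: of_rat_less\<close>)
qed

lemma translation_partial_computable: "translation_function g \<beta> \<alpha> \<Longrightarrow> partial_computable_rat g"
  unfolding translation_function_def by blast

lemma translation_range:
  assumes "translation_function g \<beta> \<alpha>" "g q = Some v"
  shows "0 \<le> v" "v < 1"
proof -
  have "v \<in> {0..<1}"
    using assms(1) ranI[of g q v, OF assms(2)] unfolding translation_function_def by blast
  then show "0 \<le> v" "v < 1" by auto
qed

text \<open>All values of \<open>g\<close> lie between \<open>0\<close> and \<open>1\<close>, so at service time \<open>\<delta>\<close> per unit the busy times have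
  measure at most \<open>\<delta>\<close>. In a cell of length \<open>2 ^ - m\<close> slopes above \<open>2 ^ (m + 1)\<close> are used, which
  makes this half of the cell.\<close>

lemma slope_bounded:
  assumes \<beta>: "\<beta> \<in> {0..<1}" "0 < \<beta>" and random: "martin_loef_random \<beta>"
    and g: "translation_function g \<beta> \<alpha>" "nondecreasing g"
  shows "\<exists>D. eventually (\<lambda>q. slope g \<beta> \<alpha> q \<le> D) (rat_at_left \<beta>)"
proof (rule ccontr)
  have \<beta>1: "\<beta> \<le> 1" using \<beta> by simp
  have less1: "x - 1 < x" for x :: real by simp
  assume "\<not> ?thesis"
  then have steep: "frequently (\<lambda>q. D < slope g \<beta> \<alpha> q) (rat_at_left \<beta>)" for D
    by (auto simp: not_eventually not_le)
  have \<alpha>: "-1 < \<alpha>" 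
  proof -
    obtain v where "g 0 = Some v" "of_rat v < \<alpha>" using translation_value[OF g(1), of 0] \<beta> by auto
    then show ?thesis using translation_range(1)[OF g(1), of 0 v] by (smt (verit) zero_le_of_rat_iff)
  qed
  let ?\<delta> = "\<lambda>m. 1 / of_nat (2 ^ (m + 1)) :: rat"
  have \<delta>: "of_rat (?\<delta> m) = (1 / 2 ^ (m + 1) :: real)" for m by (simp add: of_rat_divide of_rat_power of_rat_mult)
  have "\<not> martin_loef_random \<beta>"
  proof (rule not_random_if_triples_cover[where g = g and h = g and \<kappa> = "1 / 2" and \<delta> = ?\<delta>
        and Cond = "\<lambda>m i p r s u v w. r < s"])
    show "recursive_rat (\<lambda>x. ?\<delta> (M x))" if "recursive M" for M by (intro recursive_rat_intros recursive_intros that)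
    fix m i T
    assume T: "finite T" "\<And>r s. (r, s) \<in> T \<Longrightarrow> \<exists>p u v w. g p = Some u \<and> g r = Some v \<and> g s = Some w \<and> r < s"
    have "measure lborel (\<Union>(r, s)\<in>T. {of_rat s<..<of_rat r + of_rat (?\<delta> m) *
        (of_rat (the (g s)) - of_rat (the (g r)) :: real)}) \<le> of_rat (?\<delta> m) * (1 - 0)"
    proof (rule measure_service_clipped_le[where h = "\<lambda>q. of_rat (the (g q))"])
      show "r < s \<and> 0 \<le> (of_rat (the (g r)) :: real) \<and> of_rat (the (g r)) \<le> (of_rat (the (g s)) :: real)
          \<and> of_rat (the (g s)) \<le> (1 :: real)" if "(r, s) \<in> T" for r s
        using T(2)[OF that] translation_range[OF g(1)] nondecreasing_values[OF g(2)]
        by (fastforce simp: of_rat_less_eq less_imp_le)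
      have "r \<in> dom g" if "r \<in> fst ` T \<union> snd ` T" for r using T(2) that by fastforce
      then show "(of_rat (the (g r)) :: real) \<le> of_rat (the (g s))"
        if "r \<in> fst ` T \<union> snd ` T" "s \<in> fst ` T \<union> snd ` T" "r \<le> s" for r s
        using that g(2) unfolding nondecreasing_def by (simp add: of_rat_less_eq)
    qed (use T \<delta> in auto)
    then show "measure lborel (\<Union>(r, s)\<in>T. {of_rat s<..<of_rat r + of_rat (?\<delta> m) *
        (of_rat (the (g s)) - of_rat (the (g r)) :: real)}) \<le> 1 / 2 / 2 ^ m"
      unfolding \<delta> by simp
  next
    fix m i
    obtain r s v w where "0 \<le> r" "\<beta> - 1 < of_rat r" and rs: "r < s" "of_rat s < \<beta>" "g r = Some v" "g s = Some w"
      and "\<alpha> - 1 < of_rat v" "of_rat w < \<alpha>" and inc: "2 ^ (m + 1) * (\<beta> - of_rat r) < of_rat w - of_rat v"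
      by (rule steep_increment[OF g(1) \<beta>(2) \<beta>1 steep[of "2 ^ (m + 1)"] less1 less1]) (rule that)
    have "\<beta> < of_rat r + of_rat (?\<delta> m) * (of_rat w - of_rat v)"
      unfolding \<delta> using inc by (simp add: field_simps)
    then show "\<exists>p r s u v w. g p = Some u \<and> g r = Some v \<and> g s = Some w \<and> r < s \<and> of_rat s < \<beta> \<and>
        \<beta> < of_rat r + of_rat (?\<delta> m) * (of_rat w - of_rat v)"
      using rs by blast
  qed (use \<beta> translation_partial_computable[OF g(1)] in \<open>auto intro: decidable_rat_less\<close>)
  then show False using random by blast
qed

lemma cell_ends:
  "of_rat (of_nat i / of_nat (2 ^ m)) = real i / 2 ^ m" "of_rat (of_nat (i + 1) / of_nat (2 ^ m)) = (real i + 1) / 2 ^ m"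
  by (simp_all add: of_rat_divide of_rat_power of_rat_add)

text \<open>Let \<open>p\<close> be a point in a cell around \<open>\<beta>\<close> where the slope is below \<open>c\<close>, that is, \<open>\<alpha> - g p < c * (\<beta> -
  p)\<close>. This inequality cannot be verified, but its consequence \<open>g s - g p \<le> c * (r - p)\<close> can: it
  holds for all \<open>r\<close> close to \<open>\<beta>\<close> and all \<open>s < \<beta>\<close>. One may thus choose \<open>r\<close> and \<open>s\<close> such that in
  addition \<open>\<beta>\<close> is predicted by a slope above \<open>d\<close>. The work of the acceptable pairs is at most \<open>c\<close>
  times the length of the cell, so the predictions take up at most the fraction \<open>c / d\<close> of it.\<close>

lemma slope_no_oscillation_rat:
  fixes c d :: rat
  assumes \<beta>: "\<beta> \<in> {0..<1}" "0 < \<beta>" and random: "martin_loef_random \<beta>"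
    and g: "translation_function g \<beta> \<alpha>" "nondecreasing g" and cd: "0 < c" "c < d"
    and flat: "frequently (\<lambda>q. slope g \<beta> \<alpha> q < of_rat c) (rat_at_left \<beta>)"
    and steep: "frequently (\<lambda>q. of_rat d < slope g \<beta> \<alpha> q) (rat_at_left \<beta>)"
  shows False
proof -
  have \<beta>1: "\<beta> \<le> 1" using \<beta> by simp
  have less1: "x - 1 < x" for x :: real by simp
  let ?a = "\<lambda>m i. of_nat i / of_nat (2 ^ m) :: rat" and ?b = "\<lambda>m i. of_nat (i + 1) / of_nat (2 ^ m) :: rat"
  let ?C = "\<lambda>m i p r s u v w. ?a m i \<le> p \<and> p < r \<and> r < s \<and> s \<le> ?b m i \<and> w - u \<le> c * (r - p)"
  have \<delta>: "of_rat (1 / d) = (1 / of_rat d :: real)" by (simp add: of_rat_divide)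
  have d: "0 < d" "0 < (of_rat d :: real)" using cd by auto
  have "\<not> martin_loef_random \<beta>"
  proof (rule not_random_if_triples_cover[where g = g and h = g and \<kappa> = "of_rat c / of_rat d" and \<delta> = "\<lambda>_. 1 / d"
        and Cond = ?C])
    show "recursive_rat (\<lambda>x. 1 / d)" by (rule recursive_rat_const)
    show "of_rat c / of_rat d < (1 :: real)" using cd d by (simp add: of_rat_less)
    show "0 \<le> (of_rat c / of_rat d :: real)" using cd d by simp
    show "decidable (\<lambda>x. ?C (M x) (I x) (P x) (R x) (S x) (U x) (V x) (W x))"
      if "recursive M" "recursive I" "recursive_rat P" "recursive_rat R" "recursive_rat S" "recursive_rat U" "recursive_rat V" "recursive_rat W" for M I P R S U V W
      by (intro recursive_rat_intros recursive_intros that)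
    fix m i T
    assume T: "finite T" "\<And>r s. (r, s) \<in> T \<Longrightarrow>
      \<exists>p u v w. g p = Some u \<and> g r = Some v \<and> g s = Some w \<and> ?C m i p r s u v w"
    have "measure lborel (\<Union>(r, s)\<in>T. {of_rat s<..<of_rat r + of_rat (1 / d) *
        (of_rat (the (g s)) - of_rat (the (g r)) :: real)}) \<le> of_rat (1 / d) * (of_rat c * of_rat (?b m i - ?a m i))"
    proof (rule measure_service_oscillation_le[where h = "\<lambda>q. of_rat (the (g q))" and D = "dom g"])
      show "?a m i \<le> ?b m i" by (simp add: divide_right_mono)
      fix r s assume "(r, s) \<in> T"
      then obtain p u v w where *: "g p = Some u" "g r = Some v" "g s = Some w" "?C m i p r s u v w"
        using T(2) by blast
      then have "of_rat (w - u) \<le> (of_rat (c * (r - p)) :: real)" by (simp only: of_rat_less_eq)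
      then show "\<exists>p\<in>dom g. r \<in> dom g \<and> s \<in> dom g \<and> ?a m i \<le> p \<and> p < r \<and> r < s \<and> s \<le> ?b m i \<and>
          of_rat (the (g s)) - of_rat (the (g p)) \<le> of_rat c * (of_rat (r - p) :: real)"
        using * by (intro bexI[of _ p]) (auto simp: of_rat_diff of_rat_mult)
    next
      show "(of_rat (the (g r)) :: real) \<le> of_rat (the (g s))" if "r \<in> dom g" "s \<in> dom g" "r \<le> s" for r s
        using that g(2) unfolding nondecreasing_def by (simp add: of_rat_less_eq)
    qed (use T(1) cd d in auto)
    also have "of_rat (1 / d) * (of_rat c * of_rat (?b m i - ?a m i)) = (of_rat c / of_rat d) / (2 ^ m :: real)"
      unfolding of_rat_diff cell_ends \<delta> by (simp add: diff_divide_distrib[symmetric])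
    finally show "measure lborel (\<Union>(r, s)\<in>T. {of_rat s<..<of_rat r + of_rat (1 / d) *
        (of_rat (the (g s)) - of_rat (the (g r)) :: real)}) \<le> (of_rat c / of_rat d) / 2 ^ m" .
  next
    fix m i assume "\<beta> \<in> cell m i"
    then have I: "of_rat (?a m i) < \<beta>" "\<beta> < of_rat (?b m i)" unfolding cell_ends cell_def by (auto simp: add.commute)
    obtain p where p: "p \<in> {0..<1}" "of_rat (?a m i) < (of_rat p :: real)" "of_rat p < \<beta>" "slope g \<beta> \<alpha> p < of_rat c"
      using flat I(1) unfolding frequently_rat_at_left by blast
    obtain u where u: "g p = Some u" "of_rat u < \<alpha>" using translation_value[OF g(1) p(1,3)] .
    \<comment> \<open>Beyond \<open>L\<close> the inequality \<open>\<alpha> - u < c * (r - p)\<close> holds.\<close>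
    define L where "L = max (of_rat p) (of_rat p + (\<alpha> - of_rat u) / of_rat c)"
    have c: "0 < (of_rat c :: real)" using cd by simp
    have "L < \<beta>" using p(3,4) u c by (simp add: L_def slope_def field_simps)
    then obtain r s v w where "0 \<le> r" and rs: "L < of_rat r" "r < s" "of_rat s < \<beta>" "g r = Some v" "g s = Some w"
      and "\<alpha> - 1 < of_rat v" and w: "of_rat w < \<alpha>" and inc: "of_rat d * (\<beta> - of_rat r) < of_rat w - of_rat v"
      by (rule steep_increment[OF g(1) \<beta>(2) \<beta>1 steep _ less1]) (rule that)
    have pr: "of_rat p < (of_rat r :: real)" using rs(1) by (simp add: L_def)
    have "(\<alpha> - of_rat u) / of_rat c < of_rat r - of_rat p" using rs(1) by (simp add: L_def)
    then have "\<alpha> - of_rat u < of_rat c * (of_rat r - of_rat p)" using c by (simp add: pos_divide_less_eq mult.commute)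
    then have "of_rat (w - u) \<le> (of_rat (c * (r - p)) :: real)" using w by (simp add: of_rat_diff of_rat_mult)
    then have "w - u \<le> c * (r - p)" by (simp only: of_rat_less_eq)
    moreover have "of_rat s < (of_rat (?b m i) :: real)" using rs(3) I(2) by linarith
    ultimately have C: "?C m i p r s u v w"
      using p(2) pr rs(2) by (simp only: of_rat_less less_imp_le simp_thms)
    have "\<beta> < of_rat r + of_rat (1 / d) * (of_rat w - of_rat v)"
      unfolding \<delta> using inc d by (simp add: field_simps)
    then show "\<exists>p r s u v w. g p = Some u \<and> g r = Some v \<and> g s = Some w \<and> ?C m i p r s u v w \<and> of_rat s < \<beta> \<and>
        \<beta> < of_rat r + of_rat (1 / d) * (of_rat w - of_rat v)"
      using u(1) rs(3-5) C by blast
  qed (use \<beta> translation_partial_computable[OF g(1)] in auto)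
  then show False using random by blast
qed

text \<open>Beyond some \<open>p0\<close> every point is one where the slope of \<open>g\<close> is below \<open>c\<close>, so in a cell around \<open>\<beta>\<close> a
  single \<open>p\<close> suffices: the left end of the cell, or \<open>p0\<close> if that is larger. As \<open>h\<close> tends to the same
  \<open>\<alpha>\<close>, it gets above \<open>g p\<close>, and from there on it rises by less than \<open>c * (\<beta> - p)\<close>. The pairs with
  values of \<open>h\<close> in this range therefore carry an amount of work of at most \<open>c\<close> times the length of
  the cell. A single \<open>p\<close> per cell is important here: \<open>h\<close> may lag behind \<open>g\<close>, and then different \<open>p\<close>
  would allow work of \<open>h\<close> to be counted against the same piece of the cell.\<close>

lemma slopes_agree_rat:
  fixes c d :: rat
  assumes \<beta>: "\<beta> \<in> {0..<1}" "0 < \<beta>" and random: "martin_loef_random \<beta>"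
    and g: "translation_function g \<beta> \<alpha>"
    and h: "translation_function h \<beta> \<alpha>" "nondecreasing h" and cd: "0 < c" "c < d"
    and flat: "eventually (\<lambda>q. slope g \<beta> \<alpha> q < of_rat c) (rat_at_left \<beta>)"
    and steep: "frequently (\<lambda>q. of_rat d < slope h \<beta> \<alpha> q) (rat_at_left \<beta>)"
  shows False
proof -
  have \<beta>1: "\<beta> \<le> 1" using \<beta> by simp
  let ?a = "\<lambda>m i. of_nat i / of_nat (2 ^ m) :: rat" and ?b = "\<lambda>m i. of_nat (i + 1) / of_nat (2 ^ m) :: rat"
  obtain b where b: "b < \<beta>" "\<And>q. q \<in> {0..<1} \<Longrightarrow> b < of_rat q \<Longrightarrow> of_rat q < \<beta> \<Longrightarrow> slope g \<beta> \<alpha> q < of_rat c"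
    using flat unfolding eventually_rat_at_left by blast
  have "max 0 b < \<beta>" using b(1) \<beta>(2) by simp
  then obtain p0 where p0: "max 0 b < of_rat p0" "of_rat p0 < \<beta>" using of_rat_dense by blast
  let ?C = "\<lambda>m i p r s u v w. (?a m i \<le> p0 \<and> p = p0 \<or> p0 < ?a m i \<and> p = ?a m i) \<and> p < r \<and> r < s \<and> s \<le> ?b m i \<and>
    u \<le> v \<and> w - u \<le> c * (r - p)"
  have \<delta>: "of_rat (1 / d) = (1 / of_rat d :: real)" by (simp add: of_rat_divide)
  have d: "0 < d" "0 < (of_rat d :: real)" using cd by auto
  have c: "0 < (of_rat c :: real)" using cd by simp
  have "\<not> martin_loef_random \<beta>"
  proof (rule not_random_if_triples_cover[where g = g and h = h and \<kappa> = "of_rat c / of_rat d" and \<delta> = "\<lambda>_. 1 / d"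
        and Cond = ?C])
    show "recursive_rat (\<lambda>x. 1 / d)" by (rule recursive_rat_const)
    show "of_rat c / of_rat d < (1 :: real)" using cd d by (simp add: of_rat_less)
    show "0 \<le> (of_rat c / of_rat d :: real)" using cd d by simp
    show "decidable (\<lambda>x. ?C (M x) (I x) (P x) (R x) (S x) (U x) (V x) (W x))"
      if "recursive M" "recursive I" "recursive_rat P" "recursive_rat R" "recursive_rat S" "recursive_rat U" "recursive_rat V" "recursive_rat W" for M I P R S U V W
      by (intro recursive_rat_intros recursive_intros that)
    fix m i T
    assume T: "finite T" "\<And>r s. (r, s) \<in> T \<Longrightarrow>
      \<exists>p u v w. g p = Some u \<and> h r = Some v \<and> h s = Some w \<and> ?C m i p r s u v w"
    define p where "p = max p0 (?a m i)"
    define u where "u = the (g p)"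
    have "measure lborel (\<Union>(r, s)\<in>T. {of_rat s<..<of_rat r + of_rat (1 / d) *
        (of_rat (the (h s)) - of_rat (the (h r)) :: real)}) \<le>
        of_rat (1 / d) * (of_rat (u + c * (?b m i - ?a m i)) - of_rat u)"
    proof (rule measure_service_clipped_le[where h = "\<lambda>q. of_rat (the (h q))"])
      have "?a m i \<le> ?b m i" by (simp add: divide_right_mono)
      then have "0 \<le> c * (?b m i - ?a m i)" using cd by simp
      then show "of_rat u \<le> (of_rat (u + c * (?b m i - ?a m i)) :: real)" unfolding of_rat_less_eq by simp
      fix r s assume "(r, s) \<in> T"
      then obtain p' u' v w where *: "g p' = Some u'" "h r = Some v" "h s = Some w" "?C m i p' r s u' v w"
        using T(2) by blast
      have "p' = p" using * by (auto simp: p_def max_def)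
      then have "u' = u" using * by (simp add: u_def)
      have "?a m i \<le> p" by (simp add: p_def)
      then have "c * (r - p) \<le> c * (?b m i - ?a m i)"
        using * cd by (intro mult_left_mono diff_mono) auto
      moreover have "u \<le> v" "w - u \<le> c * (r - p)" "r < s" using * \<open>p' = p\<close> \<open>u' = u\<close> by auto
      moreover have "v \<le> w" using nondecreasing_values[OF h(2) *(2,3)] * by simp
      ultimately show "r < s \<and> of_rat u \<le> (of_rat (the (h r)) :: real) \<and>
          of_rat (the (h r)) \<le> (of_rat (the (h s)) :: real) \<and>
          of_rat (the (h s)) \<le> (of_rat (u + c * (?b m i - ?a m i)) :: real)"
        unfolding of_rat_less_eq using * by simp
    next
      have "r \<in> dom h" if "r \<in> fst ` T \<union> snd ` T" for r using T(2) that by fastforce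
      then show "(of_rat (the (h r)) :: real) \<le> of_rat (the (h s))"
        if "r \<in> fst ` T \<union> snd ` T" "s \<in> fst ` T \<union> snd ` T" "r \<le> s" for r s
        using that h(2) unfolding nondecreasing_def by (simp add: of_rat_less_eq)
    qed (use T(1) cd d in auto)
    also have "of_rat (1 / d) * (of_rat (u + c * (?b m i - ?a m i)) - of_rat u) = (of_rat c / of_rat d) / (2 ^ m :: real)"
      unfolding of_rat_add of_rat_mult of_rat_diff cell_ends \<delta> by (simp add: diff_divide_distrib[symmetric])
    finally show "measure lborel (\<Union>(r, s)\<in>T. {of_rat s<..<of_rat r + of_rat (1 / d) *
        (of_rat (the (h s)) - of_rat (the (h r)) :: real)}) \<le> (of_rat c / of_rat d) / 2 ^ m" .
  next
    fix m i assume "\<beta> \<in> cell m i"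
    then have I: "of_rat (?a m i) < \<beta>" "\<beta> < of_rat (?b m i)" unfolding cell_ends cell_def by (auto simp: add.commute)
    define p where "p = max p0 (?a m i)"
    have "of_rat p0 \<le> (of_rat p :: real)" by (simp add: p_def of_rat_less_eq)
    moreover have "of_rat p < \<beta>" using p0 I by (auto simp: p_def max_def)
    moreover have "0 < (of_rat p0 :: real)" "b < of_rat p0" "\<beta> < 1" using p0 \<beta> by auto
    ultimately have p: "0 < (of_rat p :: real)" "b < of_rat p" "of_rat p < \<beta>" "of_rat p < (1 :: real)"
      by linarith+
    then have p01: "p \<in> {0..<1}" by simp
    obtain u where u: "g p = Some u" "of_rat u < \<alpha>" using translation_value[OF g p01 p(3)] .
    \<comment> \<open>Beyond \<open>L\<close> the inequality \<open>\<alpha> - u < c * (r - p)\<close> holds.\<close>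
    define L where "L = max (of_rat p) (of_rat p + (\<alpha> - of_rat u) / of_rat c)"
    have "L < \<beta>" using p(3) b(2)[OF p01 p(2,3)] u c by (simp add: L_def slope_def field_simps)
    then obtain r s v w where "0 \<le> r" and rs: "L < of_rat r" "r < s" "of_rat s < \<beta>" "h r = Some v" "h s = Some w"
      and uv: "of_rat u < (of_rat v :: real)" and w: "of_rat w < \<alpha>"
      and inc: "of_rat d * (\<beta> - of_rat r) < of_rat w - of_rat v"
      by (rule steep_increment[OF h(1) \<beta>(2) \<beta>1 steep _ u(2)]) (rule that)
    have pr: "of_rat p < (of_rat r :: real)" using rs(1) by (simp add: L_def)
    have "(\<alpha> - of_rat u) / of_rat c < of_rat r - of_rat p" using rs(1) by (simp add: L_def)
    then have "\<alpha> - of_rat u < of_rat c * (of_rat r - of_rat p)" using c by (simp add: pos_divide_less_eq mult.commute)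
    then have "of_rat (w - u) \<le> (of_rat (c * (r - p)) :: real)" using w by (simp add: of_rat_diff of_rat_mult)
    then have "w - u \<le> c * (r - p)" by (simp only: of_rat_less_eq)
    moreover have "of_rat s < (of_rat (?b m i) :: real)" using rs(3) I(2) by linarith
    moreover have "?a m i \<le> p0 \<and> p = p0 \<or> p0 < ?a m i \<and> p = ?a m i" by (auto simp: p_def max_def)
    ultimately have C: "?C m i p r s u v w"
      using pr uv rs(2) by (simp only: of_rat_less less_imp_le simp_thms)
    have "\<beta> < of_rat r + of_rat (1 / d) * (of_rat w - of_rat v)"
      unfolding \<delta> using inc d by (simp add: field_simps)
    then show "\<exists>p r s u v w. g p = Some u \<and> h r = Some v \<and> h s = Some w \<and> ?C m i p r s u v w \<and> of_rat s < \<beta> \<and>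
        \<beta> < of_rat r + of_rat (1 / d) * (of_rat w - of_rat v)"
      using u(1) rs(3-5) C by blast
  qed (use \<beta> translation_partial_computable[OF g] translation_partial_computable[OF h(1)] in auto)
  then show False using random by blast
qed

lemma slope_no_oscillation:
  assumes \<beta>: "\<beta> \<in> {0..<1}" "0 < \<beta>" and random: "martin_loef_random \<beta>"
    and g: "translation_function g \<beta> \<alpha>" "nondecreasing g" and "x < y"
    and flat: "frequently (\<lambda>q. slope g \<beta> \<alpha> q < x) (rat_at_left \<beta>)"
    and steep: "frequently (\<lambda>q. y < slope g \<beta> \<alpha> q) (rat_at_left \<beta>)"
  shows False
proof -
  obtain c where c: "x < of_rat c" "of_rat c < y" using of_rat_dense[OF \<open>x < y\<close>] by blast
  obtain d where d: "of_rat c < (of_rat d :: real)" "of_rat d < y" using of_rat_dense[OF c(2)] by blast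
  have "frequently (\<lambda>q. slope g \<beta> \<alpha> q < x \<and> 0 < slope g \<beta> \<alpha> q) (rat_at_left \<beta>)"
    by (rule frequently_eventually_frequently[OF flat eventually_slope_pos[OF g(1)]])
  then have "0 < x" by (auto dest: frequently_ex)
  then have "0 < (of_rat c :: real)" using c(1) by linarith
  then have "0 < c" by simp
  show False
  proof (rule slope_no_oscillation_rat[OF \<beta> random g \<open>0 < c\<close>])
    show "c < d" using d(1) by (simp add: of_rat_less)
    show "frequently (\<lambda>q. slope g \<beta> \<alpha> q < of_rat c) (rat_at_left \<beta>)"
      by (rule frequently_elim1[OF flat]) (use c in simp)
    show "frequently (\<lambda>q. of_rat d < slope g \<beta> \<alpha> q) (rat_at_left \<beta>)"
      by (rule frequently_elim1[OF steep]) (use d in simp)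
  qed
qed

text \<open>The limit is the infimum of the eventual upper bounds. Below it, every number is exceeded
  frequently, hence by the absence of oscillation every smaller number is exceeded eventually.\<close>

lemma slope_convergent:
  assumes \<beta>: "\<beta> \<in> {0..<1}" "0 < \<beta>" and random: "martin_loef_random \<beta>"
    and g: "translation_function g \<beta> \<alpha>" "nondecreasing g"
  shows "\<exists>d\<ge>0. (slope g \<beta> \<alpha> \<longlongrightarrow> d) (rat_at_left \<beta>)"
proof -
  have \<beta>1: "\<beta> \<le> 1" using \<beta> by simp
  note nontrivial = rat_at_left_nontrivial[OF \<beta>(2) \<beta>1]
  define X where "X = {x. eventually (\<lambda>q. slope g \<beta> \<alpha> q \<le> x) (rat_at_left \<beta>)}"
  have nonempty: "X \<noteq> {}" using slope_bounded[OF \<beta> random g] by (auto simp: X_def)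
  have nonneg: "0 \<le> x" if "x \<in> X" for x
  proof -
    have "eventually (\<lambda>q. slope g \<beta> \<alpha> q \<le> x \<and> 0 < slope g \<beta> \<alpha> q) (rat_at_left \<beta>)"
      using that eventually_slope_pos[OF g(1)] unfolding X_def by (simp add: eventually_conj)
    then have "\<exists>q. slope g \<beta> \<alpha> q \<le> x \<and> 0 < slope g \<beta> \<alpha> q" by (rule eventually_happens'[OF nontrivial])
    then show ?thesis by auto
  qed
  define d where "d = Inf X"
  have "(slope g \<beta> \<alpha> \<longlongrightarrow> d) (rat_at_left \<beta>)"
  proof (rule order_tendstoI)
    fix y assume "d < y"
    then obtain x where "x \<in> X" "x < y" using cInf_lessD[OF nonempty] unfolding d_def by blast
    then show "eventually (\<lambda>q. slope g \<beta> \<alpha> q < y) (rat_at_left \<beta>)"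
      unfolding X_def by (auto elim: eventually_mono)
  next
    fix x assume "x < d"
    then obtain y z where yz: "x < y" "y < z" "z < d" using dense by meson
    have "z \<notin> X" using cInf_lower[of z X] nonneg yz(3) unfolding d_def by (force intro!: bdd_belowI)
    then have "frequently (\<lambda>q. z < slope g \<beta> \<alpha> q) (rat_at_left \<beta>)"
      by (simp add: X_def not_eventually not_le)
    then have "\<not> frequently (\<lambda>q. slope g \<beta> \<alpha> q < y) (rat_at_left \<beta>)"
      using slope_no_oscillation[OF \<beta> random g yz(2)] by blast
    then show "eventually (\<lambda>q. x < slope g \<beta> \<alpha> q) (rat_at_left \<beta>)"
      unfolding not_frequently not_less by (rule eventually_mono) (use yz(1) in simp)
  qed
  moreover have "0 \<le> d" unfolding d_def by (rule cInf_greatest[OF nonempty nonneg])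
  ultimately show ?thesis by blast
qed

lemma slope_limit_le:
  assumes \<beta>: "\<beta> \<in> {0..<1}" "0 < \<beta>" and random: "martin_loef_random \<beta>"
    and g: "translation_function g \<beta> \<alpha>" and h: "translation_function h \<beta> \<alpha>" "nondecreasing h"
    and lim_g: "(slope g \<beta> \<alpha> \<longlongrightarrow> d) (rat_at_left \<beta>)" and lim_h: "(slope h \<beta> \<alpha> \<longlongrightarrow> e) (rat_at_left \<beta>)"
  shows "e \<le> d"
proof (rule ccontr)
  assume "\<not> e \<le> d"
  then have "d < e" by simp
  have \<beta>1: "\<beta> \<le> 1" using \<beta> by simp
  note nontrivial = rat_at_left_nontrivial[OF \<beta>(2) \<beta>1]
  have "0 \<le> d"
    by (rule tendsto_lowerbound[OF lim_g _ nontrivial]) (rule eventually_mono[OF eventually_slope_pos[OF g]], simp)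
  obtain a where a: "d < of_rat a" "of_rat a < e" using of_rat_dense[OF \<open>d < e\<close>] by blast
  obtain b where b: "of_rat a < (of_rat b :: real)" "of_rat b < e" using of_rat_dense[OF a(2)] by blast
  show False
  proof (rule slopes_agree_rat[OF \<beta> random g h])
    have "0 < (of_rat a :: real)" using a(1) \<open>0 \<le> d\<close> by linarith
    then show "0 < a" by simp
    show "a < b" using b(1) by (simp add: of_rat_less)
    show "eventually (\<lambda>q. slope g \<beta> \<alpha> q < of_rat a) (rat_at_left \<beta>)"
      by (rule order_tendstoD(2)[OF lim_g a(1)])
    show "frequently (\<lambda>q. of_rat b < slope h \<beta> \<alpha> q) (rat_at_left \<beta>)"
      by (rule eventually_frequently[OF nontrivial order_tendstoD(1)[OF lim_h b(2)]])
  qed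
qed

theorem theorem2p1:
  fixes \<alpha> \<beta> :: real
  assumes "\<alpha> \<in> {0..<1}" and "\<beta> \<in> {0..<1}" and "martin_loef_random \<beta>"
  shows "\<exists>d::real. d \<ge> 0 \<and>
    (\<forall>g :: rat \<rightharpoonup> rat. translation_function g \<beta> \<alpha> \<and> nondecreasing g \<longrightarrow>
      ((\<lambda>q. (\<alpha> - of_rat (the (g q))) / (\<beta> - of_rat q)) \<longlongrightarrow> d) (rat_at_left \<beta>))"
proof -
  have "\<beta> \<noteq> of_rat 0" by (rule martin_loef_random_irrational[OF assms(3)])
  then have \<beta>: "\<beta> \<in> {0..<1}" "0 < \<beta>" using assms(2) by auto
  note convergent = slope_convergent[OF \<beta> assms(3)]
  note limit_le = slope_limit_le[OF \<beta> assms(3)]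
  have "\<exists>d\<ge>0. \<forall>g. translation_function g \<beta> \<alpha> \<and> nondecreasing g \<longrightarrow> (slope g \<beta> \<alpha> \<longlongrightarrow> d) (rat_at_left \<beta>)"
  proof (cases "\<exists>g. translation_function g \<beta> \<alpha> \<and> nondecreasing g")
    case True
    then obtain g where g: "translation_function g \<beta> \<alpha>" "nondecreasing g" by blast
    obtain d where d: "0 \<le> d" "(slope g \<beta> \<alpha> \<longlongrightarrow> d) (rat_at_left \<beta>)" using convergent[OF g] by blast
    have "(slope h \<beta> \<alpha> \<longlongrightarrow> d) (rat_at_left \<beta>)" if h: "translation_function h \<beta> \<alpha>" "nondecreasing h" for h
    proof -
      obtain e where e: "(slope h \<beta> \<alpha> \<longlongrightarrow> e) (rat_at_left \<beta>)" using convergent[OF h] by blast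
      have "e = d"
        using limit_le[OF g(1) h d(2) e] limit_le[OF h(1) g e d(2)] by (rule antisym)
      then show ?thesis using e by simp
    qed
    then show ?thesis using d(1) by blast
  qed auto
  then show ?thesis unfolding slope_def[abs_def] .
qed

end
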